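(* Fix $X\in\mathcal{E}$ and let $I$ be the (extended) Daniell integral associated with $X$. Then $C(\mathbb{R})\subseteq\mathbb{L}_u$, and for every continuous $f:\mathbb{R}\to\mathbb{R}$ we have $I(f)=f\circ X$; in particular $I(f)\in\mathcal{E}^u$.
   Context: Let $\mathcal{E}$ be an order complete vector lattice with a weak order unit $E$, $K$ its Stone space (extremally disconnected compact Hausdorff), and $C^\infty(K)$ the vector lattice of continuous functions $K\to[-\infty,\infty]$ finite off a nowhere dense set (identified when equal off a nowhere dense set), which is the universal completion $\mathcal{E}^u$. Fix a Maeda–Ogasawara representation of $\mathcal{E}$ as an order dense ideal of $C^\infty(K)$ with $E$ corresponding to $\mathbf{1}$. The sup-completion is $\mathcal{E}^s=\{f\in C(K,[-\infty,\infty]): f\ge g\text{ for some } g\in\mathcal{E}\}$. For $Y\in\mathcal{E}$, $P_Y$ denotes the band projection onto the band generated by $Y$. For a continuous $f:\mathbb{R}\to\mathbb{R}$ and $X\in C^\infty(K)$, $f\circ X$ denotes the unique element of $C^\infty(K)$ that agrees with $\omega\mapsto f(X(\omega))$ on the open dense set where $X$ is finite. Daniell calculus: $F(\mathbb{R})$ is the algebra of finite disjoint unions of intervals $(a,b]$, $(a,\infty)$, $(-\infty,b]$ ($a,b\in\mathbb{R}$), and $\mathbb{L}$ is the vector lattice of functions $f=\sum_{i=1}^n a_i\mathbf{1}_{S_i}$ with $a_i\in\mathbb{R}$ and $(S_i)$ a partition of $\mathbb{R}$ into sets of $F(\mathbb{R})$. For fixed $X\in\mathcal{E}$ the spectral system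 is $A_t=E-P_{(X-tE)^+}E$, with $A_\infty=\sup_tA_t$, $A_{-\infty}=\inf_tA_t$; the measure $\mu_A$ is $\mu_A(a,b]=A_b-A_a$, $\mu_A(a,\infty)=A_\infty-A_a$, $\mu_A(-\infty,b]=A_b-A_{-\infty}$, extended additively; the Daniell integral associated with $X$ is $I(f)=\sum_i a_i\mu_A(S_i)$ for $f=\sum_ia_i\mathbf{1}_{S_i}\in\mathbb{L}$. $\mathbb{L}^\uparrow$ is the set of $f:\mathbb{R}\to\overline{\mathbb{R}}$ for which there is a sequence $(f_n)\subseteq\mathbb{L}$ with $f_n(t)\uparrow f(t)$ for every $t$, and for such $f$, $I(f)=\sup_nI(f_n)\in\mathcal{E}^s$ (independent of the sequence). $\mathbb{L}^\uparrow_0$ is the set of real-valued positive functions in $\mathbb{L}^\uparrow$, $\mathbb{L}_u=\{g-h: g,h\in\mathbb{L}^\uparrow_0,\ I(g),I(h)\in\mathcal{E}^u\}$, and $I$ is extended to $\mathbb{L}_u$ by $I(g-h)=I(g)-I(h)$ (a well-defined positive linear map $\mathbb{L}_u\to\mathcal{E}^u$). *)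

theory Defs
  imports "HOL-Analysis.Analysis"
begin

text \<open>We work in the fixed Maeda-Ogasawara representation: K is the Stone space
(an extremally disconnected compact Hausdorff space), elements of the universal
completion C^infinity(K) are represented by continuous maps K -> [-infinity,infinity]
(type ereal) that are finite off a nowhere dense set, normalised to be 0 outside
topspace K.  Two such continuous functions that agree off a nowhere dense set agree
everywhere, so equality of representatives is the identification of the paper.\<close>

definition nowhere_dense_in :: "'a topology \<Rightarrow> 'a set \<Rightarrow> bool" where
  "nowhere_dense_in K S \<longleftrightarrow> K interior_of (K closure_of S) = {}"

definition extensional_on :: "'a topology \<Rightarrow> ('a \<Rightarrow> ereal) \<Rightarrow> bool" where
  "extensional_on K u \<longleftrightarrow> (\<forall>\<omega>. \<omega> \<notin> topspace K \<longrightarrow> u \<omega> = 0)"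

definition cinf :: "'a topology \<Rightarrow> ('a \<Rightarrow> ereal) set" where
  "cinf K = {u. continuous_map K euclidean u \<and> extensional_on K u \<and>
               nowhere_dense_in K {\<omega>\<in>topspace K. \<bar>u \<omega>\<bar> = \<infinity>}}"

text \<open>Vector space operations of C^infinity(K): defined pointwise on the (dense) set
where the arguments are finite, and extended (uniquely) to an element of C^infinity(K).\<close>

definition cadd :: "'a topology \<Rightarrow> ('a \<Rightarrow> ereal) \<Rightarrow> ('a \<Rightarrow> ereal) \<Rightarrow> ('a \<Rightarrow> ereal)" where
  "cadd K u v = (THE z. z \<in> cinf K \<and>
     (\<forall>\<omega>\<in>topspace K. \<bar>u \<omega>\<bar> \<noteq> \<infinity> \<and> \<bar>v \<omega>\<bar> \<noteq> \<infinity> \<longrightarrow> z \<omega> = u \<omega> + v \<omega>))"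

definition cscale :: "'a topology \<Rightarrow> real \<Rightarrow> ('a \<Rightarrow> ereal) \<Rightarrow> ('a \<Rightarrow> ereal)" where
  "cscale K c u = (THE z. z \<in> cinf K \<and>
     (\<forall>\<omega>\<in>topspace K. \<bar>u \<omega>\<bar> \<noteq> \<infinity> \<longrightarrow> z \<omega> = ereal c * u \<omega>))"

definition cminus :: "'a topology \<Rightarrow> ('a \<Rightarrow> ereal) \<Rightarrow> ('a \<Rightarrow> ereal) \<Rightarrow> ('a \<Rightarrow> ereal)" where
  "cminus K u v = cadd K u (cscale K (-1) v)"

definition czero :: "'a \<Rightarrow> ereal" where
  "czero = (\<lambda>_. 0)"

text \<open>The element corresponding to the weak order unit E.\<close>
definition cone :: "'a topology \<Rightarrow> 'a \<Rightarrow> ereal" where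
  "cone K = (\<lambda>\<omega>. if \<omega> \<in> topspace K then 1 else 0)"

definition csum :: "'a topology \<Rightarrow> ('a \<Rightarrow> ereal) list \<Rightarrow> ('a \<Rightarrow> ereal)" where
  "csum K xs = foldr (cadd K) xs czero"

definition cle :: "'a topology \<Rightarrow> ('a \<Rightarrow> ereal) \<Rightarrow> ('a \<Rightarrow> ereal) \<Rightarrow> bool" where
  "cle K u v \<longleftrightarrow> (\<forall>\<omega>\<in>topspace K. u \<omega> \<le> v \<omega>)"

definition cabs :: "('a \<Rightarrow> ereal) \<Rightarrow> ('a \<Rightarrow> ereal)" where
  "cabs u = (\<lambda>\<omega>. \<bar>u \<omega>\<bar>)"

definition cpos :: "('a \<Rightarrow> ereal) \<Rightarrow> ('a \<Rightarrow> ereal)" where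
  "cpos u = (\<lambda>\<omega>. max (u \<omega>) 0)"

definition cdisj :: "'a topology \<Rightarrow> ('a \<Rightarrow> ereal) \<Rightarrow> ('a \<Rightarrow> ereal) \<Rightarrow> bool" where
  "cdisj K u v \<longleftrightarrow> (\<forall>\<omega>\<in>topspace K. min \<bar>u \<omega>\<bar> \<bar>v \<omega>\<bar> = 0)"

definition is_lub_in :: "'a topology \<Rightarrow> ('a \<Rightarrow> ereal) set \<Rightarrow> ('a \<Rightarrow> ereal) set \<Rightarrow> ('a \<Rightarrow> ereal) \<Rightarrow> bool" where
  "is_lub_in K S B z \<longleftrightarrow> z \<in> S \<and> (\<forall>b\<in>B. cle K b z) \<and>
     (\<forall>u\<in>S. (\<forall>b\<in>B. cle K b u) \<longrightarrow> cle K z u)"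

definition is_glb_in :: "'a topology \<Rightarrow> ('a \<Rightarrow> ereal) set \<Rightarrow> ('a \<Rightarrow> ereal) set \<Rightarrow> ('a \<Rightarrow> ereal) \<Rightarrow> bool" where
  "is_glb_in K S B z \<longleftrightarrow> z \<in> S \<and> (\<forall>b\<in>B. cle K z b) \<and>
     (\<forall>u\<in>S. (\<forall>b\<in>B. cle K u b) \<longrightarrow> cle K u z)"

definition lub_in :: "'a topology \<Rightarrow> ('a \<Rightarrow> ereal) set \<Rightarrow> ('a \<Rightarrow> ereal) set \<Rightarrow> ('a \<Rightarrow> ereal)" where
  "lub_in K S B = (THE z. is_lub_in K S B z)"

definition glb_in :: "'a topology \<Rightarrow> ('a \<Rightarrow> ereal) set \<Rightarrow> ('a \<Rightarrow> ereal) set \<Rightarrow> ('a \<Rightarrow> ereal)" where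
  "glb_in K S B = (THE z. is_glb_in K S B z)"

definition is_ideal_in :: "'a topology \<Rightarrow> ('a \<Rightarrow> ereal) set \<Rightarrow> ('a \<Rightarrow> ereal) set \<Rightarrow> bool" where
  "is_ideal_in K V B \<longleftrightarrow> B \<subseteq> V \<and> czero \<in> B \<and>
     (\<forall>u\<in>B. \<forall>v\<in>B. cadd K u v \<in> B) \<and> (\<forall>c. \<forall>u\<in>B. cscale K c u \<in> B) \<and>
     (\<forall>u\<in>V. \<forall>v\<in>B. cle K (cabs u) (cabs v) \<longrightarrow> u \<in> B)"

definition order_dense_in :: "'a topology \<Rightarrow> ('a \<Rightarrow> ereal) set \<Rightarrow> ('a \<Rightarrow> ereal) set \<Rightarrow> bool" where
  "order_dense_in K V B \<longleftrightarrow>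
     (\<forall>u\<in>V. cle K czero u \<and> u \<noteq> czero \<longrightarrow> (\<exists>v\<in>B. cle K czero v \<and> v \<noteq> czero \<and> cle K v u))"

definition order_complete :: "'a topology \<Rightarrow> ('a \<Rightarrow> ereal) set \<Rightarrow> bool" where
  "order_complete K E \<longleftrightarrow>
     (\<forall>D. D \<subseteq> E \<and> D \<noteq> {} \<and> (\<exists>u\<in>E. \<forall>d\<in>D. cle K d u) \<longrightarrow> (\<exists>s. is_lub_in K E D s))"

definition is_band_in :: "'a topology \<Rightarrow> ('a \<Rightarrow> ereal) set \<Rightarrow> ('a \<Rightarrow> ereal) set \<Rightarrow> bool" where
  "is_band_in K E B \<longleftrightarrow> is_ideal_in K E B \<and> (\<forall>D s. D \<subseteq> B \<and> is_lub_in K E D s \<longrightarrow> s \<in> B)"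

definition band_gen :: "'a topology \<Rightarrow> ('a \<Rightarrow> ereal) set \<Rightarrow> ('a \<Rightarrow> ereal) \<Rightarrow> ('a \<Rightarrow> ereal) set" where
  "band_gen K E Y = \<Inter>{B. is_band_in K E B \<and> Y \<in> B}"

definition dcompl :: "'a topology \<Rightarrow> ('a \<Rightarrow> ereal) set \<Rightarrow> ('a \<Rightarrow> ereal) set \<Rightarrow> ('a \<Rightarrow> ereal) set" where
  "dcompl K E B = {w\<in>E. \<forall>b\<in>B. cdisj K w b}"

definition band_proj :: "'a topology \<Rightarrow> ('a \<Rightarrow> ereal) set \<Rightarrow> ('a \<Rightarrow> ereal) set \<Rightarrow> ('a \<Rightarrow> ereal) \<Rightarrow> ('a \<Rightarrow> ereal)" where
  "band_proj K E B z = (THE b. b \<in> B \<and> cminus K z b \<in> dcompl K E B)"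

definition P_gen :: "'a topology \<Rightarrow> ('a \<Rightarrow> ereal) set \<Rightarrow> ('a \<Rightarrow> ereal) \<Rightarrow> ('a \<Rightarrow> ereal) \<Rightarrow> ('a \<Rightarrow> ereal)" where
  "P_gen K E Y = band_proj K E (band_gen K E Y)"

definition sup_compl :: "'a topology \<Rightarrow> ('a \<Rightarrow> ereal) set \<Rightarrow> ('a \<Rightarrow> ereal) set" where
  "sup_compl K E = {f. continuous_map K euclidean f \<and> extensional_on K f \<and> (\<exists>g\<in>E. cle K g f)}"

definition ccomp :: "'a topology \<Rightarrow> (real \<Rightarrow> real) \<Rightarrow> ('a \<Rightarrow> ereal) \<Rightarrow> ('a \<Rightarrow> ereal)" where
  "ccomp K f X = (THE z. z \<in> cinf K \<and>
     (\<forall>\<omega>\<in>topspace K. \<bar>X \<omega>\<bar> \<noteq> \<infinity> \<longrightarrow> z \<omega> = ereal (f (real_of_ereal (X \<omega>)))))"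

definition spec :: "'a topology \<Rightarrow> ('a \<Rightarrow> ereal) set \<Rightarrow> ('a \<Rightarrow> ereal) \<Rightarrow> real \<Rightarrow> ('a \<Rightarrow> ereal)" where
  "spec K E X t = cminus K (cone K)
      (P_gen K E (cpos (cminus K X (cscale K t (cone K)))) (cone K))"

definition spec_top :: "'a topology \<Rightarrow> ('a \<Rightarrow> ereal) set \<Rightarrow> ('a \<Rightarrow> ereal) \<Rightarrow> ('a \<Rightarrow> ereal)" where
  "spec_top K E X = lub_in K E (range (spec K E X))"

definition spec_bot :: "'a topology \<Rightarrow> ('a \<Rightarrow> ereal) set \<Rightarrow> ('a \<Rightarrow> ereal) \<Rightarrow> ('a \<Rightarrow> ereal)" where
  "spec_bot K E X = glb_in K E (range (spec K E X))"

datatype ivl = OC real real | OpenRay real | ClosedRay real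

fun ivl_set :: "ivl \<Rightarrow> real set" where
  "ivl_set (OC a b) = {a<..b}"
| "ivl_set (OpenRay a) = {a<..}"
| "ivl_set (ClosedRay b) = {..b}"

fun ivl_ok :: "ivl \<Rightarrow> bool" where
  "ivl_ok (OC a b) = (a < b)"
| "ivl_ok (OpenRay a) = True"
| "ivl_ok (ClosedRay b) = True"

fun mu_ivl :: "'a topology \<Rightarrow> ('a \<Rightarrow> ereal) set \<Rightarrow> ('a \<Rightarrow> ereal) \<Rightarrow> ivl \<Rightarrow> ('a \<Rightarrow> ereal)" where
  "mu_ivl K E X (OC a b) = cminus K (spec K E X b) (spec K E X a)"
| "mu_ivl K E X (OpenRay a) = cminus K (spec_top K E X) (spec K E X a)"
| "mu_ivl K E X (ClosedRay b) = cminus K (spec K E X b) (spec_bot K E X)"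

definition fset_of :: "ivl list \<Rightarrow> real set" where
  "fset_of Js = (\<Union>J\<in>set Js. ivl_set J)"

definition fset_ok :: "ivl list \<Rightarrow> bool" where
  "fset_ok Js \<longleftrightarrow> (\<forall>J\<in>set Js. ivl_ok J) \<and>
     (\<forall>i<length Js. \<forall>j<length Js. i \<noteq> j \<longrightarrow> ivl_set (Js!i) \<inter> ivl_set (Js!j) = {})"

definition mu_fset :: "'a topology \<Rightarrow> ('a \<Rightarrow> ereal) set \<Rightarrow> ('a \<Rightarrow> ereal) \<Rightarrow> ivl list \<Rightarrow> ('a \<Rightarrow> ereal)" where
  "mu_fset K E X Js = csum K (map (mu_ivl K E X) Js)"

definition daniell_L_val :: "'a topology \<Rightarrow> ('a \<Rightarrow> ereal) set \<Rightarrow> ('a \<Rightarrow> ereal) \<Rightarrow>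
    (real \<Rightarrow> real) \<Rightarrow> ('a \<Rightarrow> ereal) \<Rightarrow> bool" where
  "daniell_L_val K E X f v \<longleftrightarrow> (\<exists>ps :: (real \<times> ivl list) list.
     (\<forall>p\<in>set ps. fset_ok (snd p)) \<and>
     (\<forall>i<length ps. \<forall>j<length ps. i \<noteq> j \<longrightarrow> fset_of (snd (ps!i)) \<inter> fset_of (snd (ps!j)) = {}) \<and>
     (\<Union>p\<in>set ps. fset_of (snd p)) = UNIV \<and>
     f = (\<lambda>t. \<Sum>i<length ps. fst (ps!i) * indicator (fset_of (snd (ps!i))) t) \<and>
     v = csum K (map (\<lambda>p. cscale K (fst p) (mu_fset K E X (snd p))) ps))"

definition daniell_up_val :: "'a topology \<Rightarrow> ('a \<Rightarrow> ereal) set \<Rightarrow> ('a \<Rightarrow> ereal) \<Rightarrow>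
    (real \<Rightarrow> real) \<Rightarrow> ('a \<Rightarrow> ereal) \<Rightarrow> bool" where
  "daniell_up_val K E X g v \<longleftrightarrow> (\<exists>fs vs.
     (\<forall>n. daniell_L_val K E X (fs n) (vs n)) \<and>
     (\<forall>t. incseq (\<lambda>n. fs n t) \<and> (\<lambda>n. fs n t) \<longlonglongrightarrow> g t) \<and>
     is_lub_in K (sup_compl K E) (range vs) v)"

definition L0_up_val :: "'a topology \<Rightarrow> ('a \<Rightarrow> ereal) set \<Rightarrow> ('a \<Rightarrow> ereal) \<Rightarrow>
    (real \<Rightarrow> real) \<Rightarrow> ('a \<Rightarrow> ereal) \<Rightarrow> bool" where
  "L0_up_val K E X g v \<longleftrightarrow> (\<forall>t. 0 \<le> g t) \<and> daniell_up_val K E X g v"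

end

theory Submission
  imports Defs
begin

text \<open>
  Off a nowhere dense set \<open>A\<^sub>t\<close> is the indicator of \<open>{X \<le> t}\<close>, so for a step function \<open>f\<close> the integral
  \<open>I(f)\<close> agrees with \<open>f \<circ> X\<close> off a nowhere dense set. A supremum in \<open>E\<^sup>s\<close> of a sequence agrees with the pointwise
  supremum off a meagre set, hence \<open>I(g) = g \<circ> X\<close> off a meagre set for every \<open>g\<close> in the monotone closure of
  the step functions. By the Baire category theorem continuous functions on \<open>K\<close> that agree off a
  meagre set are equal, which yields \<open>I(f) = f \<circ> X\<close> whenever \<open>f = g - h\<close> is continuous. Conversely, a
  continuous \<open>g \<ge> 0\<close> is an increasing limit of dyadic step functions, and \<open>g \<circ> X\<close> is then the
  supremum of their integrals.
\<close>

section \<open>The residual filter\<close>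

text \<open>The obstacle is that suprema of continuous functions are not pointwise and that the
  operations of \<open>cinf\<close> are prescribed only where the arguments are finite, so pointwise
  identities may fail on exceptional sets. Each such set is nowhere dense, but a sequence of step
  functions, or the rational levels of a supremum, produces countably many of them, and their union
  need not be nowhere dense. All exceptional sets are therefore absorbed into one filter closed
  under countable intersections, and what remains is real arithmetic in
  \<open>real_of_ereal (X \<omega>)\<close>; the default value 0 at infinite points is harmless,
  since these points form a nowhere dense set. Extremal disconnectedness serves two purposes:
  functions given on an open set extend continuously to \<open>K\<close>, which makes the operations
  exist, and closures of open sets are clopen, so that functions can be cut along them. Values are
  always computed for arbitrary representations, so well-definedness of the integral needs no
  argument of its own.\<close>

definition residual :: "'a topology \<Rightarrow> 'a filter" where
  "residual K = Abs_filter (\<lambda>P. \<exists>\<U>. countable \<U> \<and>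
     (\<forall>U\<in>\<U>. openin K U \<and> K closure_of U = topspace K) \<and>
     (\<forall>\<omega>\<in>topspace K. \<omega> \<in> \<Inter>\<U> \<longrightarrow> P \<omega>))"

lemma eventually_residual:
  "eventually P (residual K) \<longleftrightarrow> (\<exists>\<U>. countable \<U> \<and>
     (\<forall>U\<in>\<U>. openin K U \<and> K closure_of U = topspace K) \<and>
     (\<forall>\<omega>\<in>topspace K. \<omega> \<in> \<Inter>\<U> \<longrightarrow> P \<omega>))"
  unfolding residual_def
proof (rule eventually_Abs_filter, rule is_filter.intro, goal_cases)
  case 1
  show ?case by (rule exI[of _ "{}"]) auto
next
  case (2 P Q)
  then obtain \<U> \<V> where
    "countable \<U>" "\<forall>U\<in>\<U>. openin K U \<and> K closure_of U = topspace K" "\<forall>\<omega>\<in>topspace K. \<omega> \<in> \<Inter>\<U> \<longrightarrow> P \<omega>"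
    "countable \<V>" "\<forall>U\<in>\<V>. openin K U \<and> K closure_of U = topspace K" "\<forall>\<omega>\<in>topspace K. \<omega> \<in> \<Inter>\<V> \<longrightarrow> Q \<omega>"
    by blast
  then show ?case by (intro exI[of _ "\<U> \<union> \<V>"]) auto
next
  case (3 P Q)
  from 3(2) obtain \<U> where
    "countable \<U>" "\<forall>U\<in>\<U>. openin K U \<and> K closure_of U = topspace K" "\<forall>\<omega>\<in>topspace K. \<omega> \<in> \<Inter>\<U> \<longrightarrow> P \<omega>"
    by blast
  with 3(1) show ?case by (intro exI[of _ \<U>]) auto
qed

lemma eventually_residual_topspace: "\<forall>\<^sub>F \<omega> in residual K. \<omega> \<in> topspace K"
  unfolding eventually_residual by (rule exI[of _ "{}"]) auto

lemma eventually_residual_open_dense: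
  assumes "openin K U" "K closure_of U = topspace K"
  shows "\<forall>\<^sub>F \<omega> in residual K. \<omega> \<in> U"
  unfolding eventually_residual using assms by (intro exI[of _ "{U}"]) auto

text \<open>This is what the filter gains over the one generated by the dense open sets. It is used
  for sequences and for families indexed by the rationals.\<close>

lemma eventually_residual_all_countable:
  assumes "countable I" "\<And>i. i \<in> I \<Longrightarrow> \<forall>\<^sub>F \<omega> in residual K. P i \<omega>"
  shows "\<forall>\<^sub>F \<omega> in residual K. \<forall>i\<in>I. P i \<omega>"
proof -
  have "\<forall>i\<in>I. \<exists>\<U>. countable \<U> \<and> (\<forall>U\<in>\<U>. openin K U \<and> K closure_of U = topspace K) \<and>
     (\<forall>\<omega>\<in>topspace K. \<omega> \<in> \<Inter>\<U> \<longrightarrow> P i \<omega>)"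
    using assms(2) unfolding eventually_residual by blast
  then obtain \<U> where \<U>: "\<forall>i\<in>I. countable (\<U> i) \<and>
      (\<forall>U\<in>\<U> i. openin K U \<and> K closure_of U = topspace K) \<and>
      (\<forall>\<omega>\<in>topspace K. \<omega> \<in> \<Inter>(\<U> i) \<longrightarrow> P i \<omega>)"
    by metis
  show ?thesis
    unfolding eventually_residual
  proof (intro exI[of _ "\<Union>(\<U> ` I)"] conjI ballI impI)
    show "countable (\<Union>(\<U> ` I))" using assms(1) \<U> by auto
  qed (use \<U> in auto)
qed

text \<open>The boundary of an open set is nowhere dense: the set together with its exterior is open
  and dense.\<close>

lemma eventually_residual_closure_imp:
  assumes "openin K U"
  shows "\<forall>\<^sub>F \<omega> in residual K. \<omega> \<in> K closure_of U \<longrightarrow> \<omega> \<in> U"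
proof -
  let ?W = "U \<union> (topspace K - K closure_of U)"
  have "topspace K \<subseteq> K closure_of U \<union> K closure_of (topspace K - K closure_of U)"
    using closure_of_subset[of "topspace K - K closure_of U" K] by auto
  then have "K closure_of ?W = topspace K"
    by (metis closure_of_Un closure_of_subset_topspace subset_antisym)
  moreover have "openin K ?W" using assms by (intro openin_Un openin_diff) auto
  ultimately have "\<forall>\<^sub>F \<omega> in residual K. \<omega> \<in> ?W" by (intro eventually_residual_open_dense)
  then show ?thesis by eventually_elim auto
qed

lemma residual_dense:
  assumes "compact_space K" "Hausdorff_space K" "\<forall>\<^sub>F \<omega> in residual K. P \<omega>"
  shows "K closure_of {\<omega>\<in>topspace K. P \<omega>} = topspace K"
proof -
  obtain \<U> where \<U>: "countable \<U>" "\<And>U. U \<in> \<U> \<Longrightarrow> openin K U \<and> K closure_of U = topspace K"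
      "\<forall>\<omega>\<in>topspace K. \<omega> \<in> \<Inter>\<U> \<longrightarrow> P \<omega>"
    using assms(3) unfolding eventually_residual by blast
  have "K closure_of \<Inter>\<U> = topspace K"
    by (rule Baire_category[OF _ \<U>(1,2)])
      (use assms compact_Hausdorff_imp_regular_space compact_imp_locally_compact_space in auto)
  \<comment> \<open>Restricting to \<open>topspace K\<close> matters for an empty family, whose
    intersection is \<open>UNIV\<close>.\<close>
  then have "topspace K \<subseteq> K closure_of (topspace K \<inter> \<Inter>\<U>)"
    by (simp add: closure_of_restrict[symmetric])
  also have "\<dots> \<subseteq> K closure_of {\<omega>\<in>topspace K. P \<omega>}"
    by (rule closure_of_mono) (use \<U>(3) in auto)
  finally show ?thesis by (simp add: closure_of_subset_topspace subset_antisym)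
qed

section \<open>Continuous functions into the extended reals\<close>

text \<open>Open rays form a subbasis of the order topology.\<close>

lemma continuous_map_linorderI:
  fixes u :: "'a \<Rightarrow> 'b::linorder_topology"
  assumes "\<And>a. openin K {\<omega>\<in>topspace K. u \<omega> < a}" "\<And>a. openin K {\<omega>\<in>topspace K. a < u \<omega>}"
  shows "continuous_map K euclidean u"
proof -
  have "openin K {\<omega>\<in>topspace K. u \<omega> \<in> U}" if "open U" for U
  proof -
    have "generate_topology (range (\<lambda>a. {..< a}) \<union> range (\<lambda>a. {a <..})) U"
      using that by (simp add: open_generated_order)
    then show ?thesis
    proof induction
      case UNIV
      then show ?case by simp
    next
      case (Int A B)
      have "{\<omega>\<in>topspace K. u \<omega> \<in> A \<inter> B} = {\<omega>\<in>topspace K. u \<omega> \<in> A} \<inter> {\<omega>\<in>topspace K. u \<omega> \<in> B}"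
        by auto
      then show ?case using Int by auto
    next
      case (UN \<A>)
      have "{\<omega>\<in>topspace K. u \<omega> \<in> \<Union>\<A>} = \<Union>((\<lambda>A. {\<omega>\<in>topspace K. u \<omega> \<in> A}) ` \<A>)" by auto
      then show ?case using UN by auto
    next
      case (Basis S)
      then show ?case using assms by auto
    qed
  qed
  then show ?thesis by (auto simp: continuous_map_def)
qed

text \<open>Redefining a function on one side of a clopen set is how upper bounds are lowered in the
  supremum arguments below.\<close>

lemma continuous_map_paste:
  assumes "openin K C" "closedin K C" "continuous_map K Y u" "continuous_map K Y v"
  shows "continuous_map K Y (\<lambda>\<omega>. if \<omega> \<in> C then u \<omega> else v \<omega>)"
  unfolding continuous_map_def
proof (intro conjI allI impI)
  show "(\<lambda>\<omega>. if \<omega> \<in> C then u \<omega> else v \<omega>) \<in> topspace K \<rightarrow> topspace Y"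
    using assms by (auto simp: continuous_map_def)
  fix U assume "openin Y U"
  then have "openin K (C \<inter> {\<omega>\<in>topspace K. u \<omega> \<in> U} \<union> (topspace K - C) \<inter> {\<omega>\<in>topspace K. v \<omega> \<in> U})"
    using assms by (intro openin_Un openin_Int openin_continuous_map_preimage) auto
  also have "\<dots> = {\<omega>\<in>topspace K. (if \<omega> \<in> C then u \<omega> else v \<omega>) \<in> U}"
    by auto
  finally show "openin K {\<omega>\<in>topspace K. (if \<omega> \<in> C then u \<omega> else v \<omega>) \<in> U}" .
qed

lemma openin_continuous_map_less:
  fixes u v :: "'a \<Rightarrow> ereal"
  assumes "continuous_map K euclidean u" "continuous_map K euclidean v"
  shows "openin K {\<omega>\<in>topspace K. u \<omega> < v \<omega>}"
proof -
  have "{\<omega>\<in>topspace K. u \<omega> < v \<omega>} =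
      (\<Union>q. {\<omega>\<in>topspace K. u \<omega> \<in> {..<q}} \<inter> {\<omega>\<in>topspace K. v \<omega> \<in> {q<..}})" (is "?L = ?R")
  proof (intro equalityI subsetI)
    fix \<omega> assume \<omega>: "\<omega> \<in> ?L"
    then obtain q where "u \<omega> < q" "q < v \<omega>" using dense by blast
    then show "\<omega> \<in> ?R" using \<omega> by auto
  qed (use order.strict_trans in blast)
  moreover have "openin K ?R"
    using assms by (intro openin_Union) (auto intro!: openin_Int openin_continuous_map_preimage
        simp del: greaterThan_iff lessThan_iff)
  ultimately show ?thesis by simp
qed

lemma continuous_map_ereal_max_min:
  fixes u v :: "'a \<Rightarrow> ereal"
  assumes "continuous_map K euclidean u" "continuous_map K euclidean v"
  shows "continuous_map K euclidean (\<lambda>\<omega>. max (u \<omega>) (v \<omega>))"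
    and "continuous_map K euclidean (\<lambda>\<omega>. min (u \<omega>) (v \<omega>))"
proof -
  have 1: "openin K {\<omega>\<in>topspace K. u \<omega> < a}" "openin K {\<omega>\<in>topspace K. v \<omega> < a}"
       "openin K {\<omega>\<in>topspace K. a < u \<omega>}" "openin K {\<omega>\<in>topspace K. a < v \<omega>}" for a
    using assms by (auto intro: openin_continuous_map_less)
  have 2: "{\<omega>\<in>topspace K. P \<omega> \<and> Q \<omega>} = {\<omega>\<in>topspace K. P \<omega>} \<inter> {\<omega>\<in>topspace K. Q \<omega>}"
          "{\<omega>\<in>topspace K. P \<omega> \<or> Q \<omega>} = {\<omega>\<in>topspace K. P \<omega>} \<union> {\<omega>\<in>topspace K. Q \<omega>}" for P Q by auto
  show "continuous_map K euclidean (\<lambda>\<omega>. max (u \<omega>) (v \<omega>))"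
    and "continuous_map K euclidean (\<lambda>\<omega>. min (u \<omega>) (v \<omega>))"
    by (rule continuous_map_linorderI;
        simp add: less_max_iff_disj min_less_iff_disj 2 1 openin_Int openin_Un)+
qed

section \<open>Continuous extended real functions on an extremally disconnected compact Hausdorff
  space\<close>

locale stone_space =
  fixes K :: "'a topology"
  assumes compact: "compact_space K"
    and hausdorff: "Hausdorff_space K"
    and extremally_disconnected: "openin K U \<Longrightarrow> openin K (K closure_of U)"
begin

text \<open>The set where \<open>u \<le> v\<close> is closed, and it is dense by Baire, hence
  everything. Nearly every inequality at all points is obtained in this way from one off a meagre
  set.\<close>

lemma cle_residual:
  assumes "continuous_map K euclidean u" "continuous_map K euclidean v"
    and "\<forall>\<^sub>F \<omega> in residual K. u \<omega> \<le> v \<omega>"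
  shows "cle K u v"
proof -
  have "closedin K (topspace K - {\<omega>\<in>topspace K. v \<omega> < u \<omega>})"
    using openin_continuous_map_less[OF assms(2,1)] by blast
  moreover have "topspace K - {\<omega>\<in>topspace K. v \<omega> < u \<omega>} = {\<omega>\<in>topspace K. u \<omega> \<le> v \<omega>}" by auto
  ultimately have "{\<omega>\<in>topspace K. u \<omega> \<le> v \<omega>} = topspace K"
    using residual_dense[OF compact hausdorff assms(3)] closure_of_closedin by metis
  then show ?thesis by (auto simp: cle_def)
qed

lemma residual_eqI:
  assumes "continuous_map K euclidean u" "continuous_map K euclidean v"
    and "extensional_on K u" "extensional_on K v"
    and "\<forall>\<^sub>F \<omega> in residual K. u \<omega> = v \<omega>"
  shows "u = v"
proof
  fix \<omega>
  have "cle K u v" "cle K v u"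
    using assms by (auto intro!: cle_residual elim: eventually_mono)
  then show "u \<omega> = v \<omega>"
    using assms(3,4) by (cases "\<omega> \<in> topspace K") (auto simp: cle_def extensional_on_def antisym)
qed

lemma cinf_eqI: "u \<in> cinf K \<Longrightarrow> v \<in> cinf K \<Longrightarrow> \<forall>\<^sub>F \<omega> in residual K. u \<omega> = v \<omega> \<Longrightarrow> u = v"
  by (rule residual_eqI) (simp_all add: cinf_def)

lemma finite_part_open:
  assumes "continuous_map K euclidean u"
  shows "openin K {\<omega>\<in>topspace K. \<bar>u \<omega> :: ereal\<bar> \<noteq> \<infinity>}"
proof -
  have "{\<omega>\<in>topspace K. \<bar>u \<omega>\<bar> \<noteq> \<infinity>} = {\<omega>\<in>topspace K. u \<omega> \<in> - {\<infinity>, - \<infinity>}}"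
    by (intro Collect_cong conj_cong refl) (metis ComplI Compl_iff abs_ereal.simps(2,3) ereal_infinity_cases insert_iff singletonD)
  moreover have "open (- {\<infinity>, - \<infinity> :: ereal})" by (intro open_Compl finite_imp_closed) simp
  then have "openin K {\<omega>\<in>topspace K. u \<omega> \<in> - {\<infinity>, - \<infinity>}}"
    by (intro openin_continuous_map_preimage[OF assms]) simp
  ultimately show ?thesis by argo
qed

lemma finite_part_dense:
  assumes "u \<in> cinf K"
  shows "K closure_of {\<omega>\<in>topspace K. \<bar>u \<omega>\<bar> \<noteq> \<infinity>} = topspace K"
proof -
  let ?S = "{\<omega>\<in>topspace K. \<bar>u \<omega>\<bar> = \<infinity>}"
  have eq: "{\<omega>\<in>topspace K. \<bar>u \<omega>\<bar> \<noteq> \<infinity>} = topspace K - ?S" by auto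
  have "K interior_of ?S = {}"
    using assms interior_of_mono[OF closure_of_subset[of ?S K]]
    by (auto simp: cinf_def nowhere_dense_in_def)
  then show ?thesis unfolding eq closure_of_complement by simp
qed

lemma cinf_residual_finite: "u \<in> cinf K \<Longrightarrow> \<forall>\<^sub>F \<omega> in residual K. \<omega> \<in> topspace K \<and> \<bar>u \<omega>\<bar> \<noteq> \<infinity>"
  using eventually_residual_open_dense[OF finite_part_open finite_part_dense, of u]
  by (simp add: cinf_def)

text \<open>The infinite part is closed, and a residual set is dense, so finiteness off a meagre set
  already makes the infinite part nowhere dense.\<close>

lemma cinfI:
  assumes "continuous_map K euclidean u" "extensional_on K u"
    and "\<forall>\<^sub>F \<omega> in residual K. \<bar>u \<omega>\<bar> \<noteq> \<infinity>"
  shows "u \<in> cinf K"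
proof -
  let ?F = "{\<omega>\<in>topspace K. \<bar>u \<omega>\<bar> \<noteq> \<infinity>}"
  have cl: "closedin K (topspace K - ?F)"
    using finite_part_open[OF assms(1)] by blast
  have eq: "{\<omega>\<in>topspace K. \<bar>u \<omega>\<bar> = \<infinity>} = topspace K - ?F" by auto
  have "K interior_of (topspace K - ?F) = {}"
    using residual_dense[OF compact hausdorff assms(3)] by (simp add: interior_of_complement)
  then have "nowhere_dense_in K {\<omega>\<in>topspace K. \<bar>u \<omega>\<bar> = \<infinity>}"
    unfolding nowhere_dense_in_def eq using cl by (simp add: closure_of_closedin)
  then show ?thesis using assms by (simp add: cinf_def)
qed

text \<open>The set \<open>{z > a}\<close> is the union of the clopen sets \<open>cl {\<phi> > r}\<close>, \<open>r > a\<close>, and \<open>{z < a}\<close>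
  that of their complements for \<open>r < a\<close>; extremal disconnectedness makes both open.\<close>

lemma continuous_extension:
  fixes \<phi> :: "'a \<Rightarrow> ereal"
  assumes "openin K U" and \<phi>: "continuous_map (subtopology K U) euclidean \<phi>"
  obtains z where "continuous_map K euclidean z" "extensional_on K z" "\<And>\<omega>. \<omega> \<in> U \<Longrightarrow> z \<omega> = \<phi> \<omega>"
proof
  define C where "C r = K closure_of {x\<in>U. r < \<phi> x}" for r
  define z where "z \<omega> = (if \<omega> \<in> topspace K then Sup {r. \<omega> \<in> C r} else 0)" for \<omega>
  have Usub: "U \<subseteq> topspace K" using assms(1) openin_subset by auto
  have opn: "openin K {x\<in>U. r < \<phi> x}" "openin K {x\<in>U. \<phi> x < r}" for r
  proof -
    have "openin (subtopology K U) {x\<in>topspace (subtopology K U). r < \<phi> x}"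
         "openin (subtopology K U) {x\<in>topspace (subtopology K U). \<phi> x < r}"
      using \<phi> by (auto intro: openin_continuous_map_less simp del: topspace_subtopology)
    moreover have "{x\<in>topspace (subtopology K U). r < \<phi> x} = {x\<in>U. r < \<phi> x}"
        "{x\<in>topspace (subtopology K U). \<phi> x < r} = {x\<in>U. \<phi> x < r}"
      using Usub by auto
    ultimately show "openin K {x\<in>U. r < \<phi> x}" "openin K {x\<in>U. \<phi> x < r}"
      unfolding openin_open_subtopology[OF assms(1)] by argo+
  qed
  have Copen: "openin K (C r)" for r
    unfolding C_def by (rule extremally_disconnected[OF opn(1)])
  have Cclosed: "closedin K (C r)" for r unfolding C_def by simp
  have Csub: "C r \<subseteq> topspace K" for r using Copen openin_subset by auto
  have Cmono: "C s \<subseteq> C r" if "r \<le> s" for r s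
    unfolding C_def by (rule closure_of_mono) (use that in auto)
  have le: "r \<le> z \<omega>" if "\<omega> \<in> C r" for r \<omega>
    using that Csub by (auto simp: z_def intro!: Sup_upper)
  have ge: "z \<omega> \<le> r" if "\<omega> \<in> topspace K" "\<omega> \<notin> C r" for r \<omega>
  proof -
    have "s \<le> r" if "\<omega> \<in> C s" for s
      using that \<open>\<omega> \<notin> C r\<close> Cmono[of r s] by (cases "r \<le> s") auto
    then show ?thesis using that(1) by (auto simp: z_def intro!: Sup_least)
  qed
  show "continuous_map K euclidean z"
  proof (rule continuous_map_linorderI)
    fix a
    have "{\<omega>\<in>topspace K. z \<omega> < a} = (\<Union>r\<in>{..<a}. topspace K - C r)"
    proof (intro equalityI subsetI)
      fix \<omega> assume \<omega>: "\<omega> \<in> {\<omega>\<in>topspace K. z \<omega> < a}"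
      then obtain r where "z \<omega> < r" "r < a" using dense[of "z \<omega>" a] by auto
      then have "\<omega> \<notin> C r" using le[of \<omega> r] by auto
      then show "\<omega> \<in> (\<Union>r\<in>{..<a}. topspace K - C r)" using \<open>r < a\<close> \<omega> by auto
    qed (use ge in \<open>auto intro: le_less_trans\<close>)
    moreover have "openin K (\<Union>r\<in>{..<a}. topspace K - C r)"
      using Cclosed by (intro openin_clauses(3)) blast
    ultimately show "openin K {\<omega>\<in>topspace K. z \<omega> < a}" by simp
    have "{\<omega>\<in>topspace K. a < z \<omega>} = (\<Union>r\<in>{a<..}. C r)"
    proof (intro equalityI subsetI)
      fix \<omega> assume \<omega>: "\<omega> \<in> {\<omega>\<in>topspace K. a < z \<omega>}"
      then obtain r where "a < r" "r < z \<omega>" using dense[of a "z \<omega>"] by auto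
      then have "\<omega> \<in> C r" using ge[of \<omega> r] \<omega> by (simp add: not_le[symmetric]) argo
      then show "\<omega> \<in> (\<Union>r\<in>{a<..}. C r)" using \<open>a < r\<close> by auto
    qed (use le Csub in \<open>auto intro: less_le_trans\<close>)
    then show "openin K {\<omega>\<in>topspace K. a < z \<omega>}" using Copen by auto
  qed
  show "extensional_on K z" by (auto simp: extensional_on_def z_def)
  fix \<omega> assume \<omega>: "\<omega> \<in> U"
  show "z \<omega> = \<phi> \<omega>"
  proof (rule antisym)
    show "z \<omega> \<le> \<phi> \<omega>"
    proof (rule dense_ge)
      fix r assume r: "\<phi> \<omega> < r"
      \<comment> \<open>An open set disjoint from a second set is disjoint from its closure, so
        passing from \<open>{\<phi> > r}\<close> to its closure adds no point where
        \<open>\<phi> < r\<close>.\<close>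
      have "{x\<in>U. \<phi> x < r} \<inter> C r = {}"
        unfolding C_def openin_Int_closure_of_eq_empty[OF opn(2)] by auto
      then have "\<omega> \<notin> C r" using \<omega> r by auto
      then show "z \<omega> \<le> r" using ge \<omega> Usub by auto
    qed
    show "\<phi> \<omega> \<le> z \<omega>"
    proof (rule dense_le)
      fix r assume "r < \<phi> \<omega>"
      then have "\<omega> \<in> {x\<in>U. r < \<phi> x}" using \<omega> by auto
      then have "\<omega> \<in> C r" unfolding C_def using closure_of_subset[OF openin_subset[OF opn(1)]] by blast
      then show "r \<le> z \<omega>" by (rule le)
    qed
  qed
qed

text \<open>The unique existence is what the descriptions in \<open>cadd\<close>,
  \<open>cscale\<close> and \<open>ccomp\<close> require, with \<open>Q\<close> saying that the
  arguments are finite. The real function \<open>\<phi>\<close> carries the continuity, while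
  \<open>\<psi>\<close> is the extended real expression written in the definition. Uniqueness holds
  because \<open>Q\<close> fixes the values off a meagre set.\<close>

lemma cinf_extension:
  fixes \<phi> :: "'a \<Rightarrow> real"
  assumes "openin K {\<omega>\<in>topspace K. Q \<omega>}" "\<forall>\<^sub>F \<omega> in residual K. Q \<omega>"
    and "continuous_map (subtopology K {\<omega>\<in>topspace K. Q \<omega>}) euclidean \<phi>"
    and \<psi>: "\<And>\<omega>. \<omega> \<in> topspace K \<Longrightarrow> Q \<omega> \<Longrightarrow> \<psi> \<omega> = ereal (\<phi> \<omega>)"
  shows "\<exists>!z. z \<in> cinf K \<and> (\<forall>\<omega>\<in>topspace K. Q \<omega> \<longrightarrow> z \<omega> = \<psi> \<omega>)"
proof -
  have U: "\<forall>\<^sub>F \<omega> in residual K. \<omega> \<in> topspace K \<and> Q \<omega>"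
    using eventually_residual_topspace assms(2) by eventually_elim simp
  have "continuous_map (subtopology K {\<omega>\<in>topspace K. Q \<omega>}) euclidean (ereal \<circ> \<phi>)"
    using assms(3) by (rule continuous_map_compose) (simp add: continuous_on_ereal)
  from continuous_extension[OF assms(1) this]
  obtain z where z: "continuous_map K euclidean z" "extensional_on K z"
      "\<And>\<omega>. \<omega> \<in> {\<omega>\<in>topspace K. Q \<omega>} \<Longrightarrow> z \<omega> = (ereal \<circ> \<phi>) \<omega>"
    by blast
  have z3: "z \<omega> = \<psi> \<omega>" "\<psi> \<omega> = ereal (\<phi> \<omega>)" if "\<omega> \<in> topspace K" "Q \<omega>" for \<omega>
    using z(3)[of \<omega>] that \<psi>[of \<omega>] by simp_all
  have "\<forall>\<^sub>F \<omega> in residual K. \<bar>z \<omega>\<bar> \<noteq> \<infinity>" using U by eventually_elim (simp add: z3)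
  then have zc: "z \<in> cinf K" using z by (intro cinfI)
  show ?thesis
  proof (rule ex1I[of _ z])
    show "z \<in> cinf K \<and> (\<forall>\<omega>\<in>topspace K. Q \<omega> \<longrightarrow> z \<omega> = \<psi> \<omega>)" using zc z3 by simp
    fix w assume w: "w \<in> cinf K \<and> (\<forall>\<omega>\<in>topspace K. Q \<omega> \<longrightarrow> w \<omega> = \<psi> \<omega>)"
    have "\<forall>\<^sub>F \<omega> in residual K. w \<omega> = z \<omega>" using U by eventually_elim (use w z3 in simp)
    then show "w = z" using w zc cinf_eqI by simp
  qed
qed

lemma continuous_map_real_of_ereal:
  assumes "continuous_map K euclidean u" "\<And>\<omega>. \<omega> \<in> topspace K \<Longrightarrow> Q \<omega> \<Longrightarrow> \<bar>u \<omega>\<bar> \<noteq> \<infinity>"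
  shows "continuous_map (subtopology K {\<omega>\<in>topspace K. Q \<omega>}) euclideanreal (\<lambda>\<omega>. real_of_ereal (u \<omega>))"
proof -
  have "continuous_map (subtopology K {\<omega>\<in>topspace K. Q \<omega>}) (top_of_set (UNIV - {\<infinity>, -\<infinity>})) u"
  proof (rule continuous_map_into_subtopology)
    show "u \<in> topspace (subtopology K {\<omega>\<in>topspace K. Q \<omega>}) \<rightarrow> UNIV - {\<infinity>, - \<infinity>}"
      using assms(2) by fastforce
  qed (rule continuous_map_from_subtopology[OF assms(1)])
  from continuous_map_compose[OF this, of euclidean real_of_ereal]
  show ?thesis using continuous_on_real by (simp add: comp_def)
qed

section \<open>Composition and vector operations\<close>

lemma ccomp_props:
  assumes "X \<in> cinf K" "continuous_on UNIV f"
  shows "ccomp K f X \<in> cinf K"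
    and "\<forall>\<^sub>F \<omega> in residual K. ccomp K f X \<omega> = ereal (f (real_of_ereal (X \<omega>)))"
proof -
  have X: "continuous_map K euclidean X" using assms by (simp add: cinf_def)
  have ev: "\<forall>\<^sub>F \<omega> in residual K. \<bar>X \<omega>\<bar> \<noteq> \<infinity>"
    using cinf_residual_finite[OF assms(1)] by eventually_elim simp
  have "continuous_map (subtopology K {\<omega>\<in>topspace K. \<bar>X \<omega>\<bar> \<noteq> \<infinity>}) euclidean (f \<circ> (\<lambda>\<omega>. real_of_ereal (X \<omega>)))"
    by (rule continuous_map_compose[OF continuous_map_real_of_ereal[OF X]]) (use assms in auto)
  from theI'[OF cinf_extension[OF finite_part_open[OF X] ev this, of "\<lambda>\<omega>. ereal (f (real_of_ereal (X \<omega>)))"]]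
  have *: "ccomp K f X \<in> cinf K \<and>
      (\<forall>\<omega>\<in>topspace K. \<bar>X \<omega>\<bar> \<noteq> \<infinity> \<longrightarrow> ccomp K f X \<omega> = ereal (f (real_of_ereal (X \<omega>))))"
    unfolding ccomp_def[symmetric] by simp
  then show "ccomp K f X \<in> cinf K" by simp
  show "\<forall>\<^sub>F \<omega> in residual K. ccomp K f X \<omega> = ereal (f (real_of_ereal (X \<omega>)))"
    using cinf_residual_finite[OF assms(1)] by eventually_elim (use * in simp)
qed

text \<open>The value is given twice: at each finite point, since membership in bands and
  disjointness are conditions at every point, and off a meagre set, for computing with
  values.\<close>

lemma cscale_props:
  assumes "u \<in> cinf K"
  shows "cscale K c u \<in> cinf K"
    and "\<And>\<omega>. \<omega> \<in> topspace K \<Longrightarrow> \<bar>u \<omega>\<bar> \<noteq> \<infinity> \<Longrightarrow> cscale K c u \<omega> = ereal c * u \<omega>"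
    and "\<forall>\<^sub>F \<omega> in residual K. cscale K c u \<omega> = ereal c * u \<omega>"
proof -
  have u: "continuous_map K euclidean u" using assms by (simp add: cinf_def)
  have ev: "\<forall>\<^sub>F \<omega> in residual K. \<bar>u \<omega>\<bar> \<noteq> \<infinity>"
    using cinf_residual_finite[OF assms(1)] by eventually_elim simp
  have \<phi>: "continuous_map (subtopology K {\<omega>\<in>topspace K. \<bar>u \<omega>\<bar> \<noteq> \<infinity>}) euclidean (\<lambda>\<omega>. c * real_of_ereal (u \<omega>))"
    by (intro continuous_map_real_mult continuous_map_real_of_ereal[OF u]) auto
  have "ereal c * u \<omega> = ereal (c * real_of_ereal (u \<omega>))" if "\<bar>u \<omega>\<bar> \<noteq> \<infinity>" for \<omega>
    using that by (cases "u \<omega>") auto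
  from theI'[OF cinf_extension[OF finite_part_open[OF u] ev \<phi> this]]
  have *: "cscale K c u \<in> cinf K \<and> (\<forall>\<omega>\<in>topspace K. \<bar>u \<omega>\<bar> \<noteq> \<infinity> \<longrightarrow> cscale K c u \<omega> = ereal c * u \<omega>)"
    unfolding cscale_def[symmetric] by simp
  then show "cscale K c u \<in> cinf K"
    "\<And>\<omega>. \<omega> \<in> topspace K \<Longrightarrow> \<bar>u \<omega>\<bar> \<noteq> \<infinity> \<Longrightarrow> cscale K c u \<omega> = ereal c * u \<omega>" by simp_all
  show "\<forall>\<^sub>F \<omega> in residual K. cscale K c u \<omega> = ereal c * u \<omega>"
    using cinf_residual_finite[OF assms] by eventually_elim (use * in simp)
qed

lemma cadd_props:
  assumes "u \<in> cinf K" "v \<in> cinf K"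
  shows "cadd K u v \<in> cinf K"
    and "\<And>\<omega>. \<omega> \<in> topspace K \<Longrightarrow> \<bar>u \<omega>\<bar> \<noteq> \<infinity> \<Longrightarrow> \<bar>v \<omega>\<bar> \<noteq> \<infinity> \<Longrightarrow> cadd K u v \<omega> = u \<omega> + v \<omega>"
    and "\<forall>\<^sub>F \<omega> in residual K. cadd K u v \<omega> = u \<omega> + v \<omega>"
proof -
  let ?F = "\<lambda>u. {\<omega>\<in>topspace K. \<bar>u \<omega> :: ereal\<bar> \<noteq> \<infinity>}"
  let ?U = "{\<omega>\<in>topspace K. \<bar>u \<omega>\<bar> \<noteq> \<infinity> \<and> \<bar>v \<omega>\<bar> \<noteq> \<infinity>}"
  have uv: "continuous_map K euclidean u" "continuous_map K euclidean v"
    using assms by (simp_all add: cinf_def)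
  have "?U = ?F u \<inter> ?F v" by (rule set_eqI, unfold Int_iff mem_Collect_eq, argo)
  then have U: "openin K ?U" using finite_part_open uv by (simp add: openin_Int)
  have ev: "\<forall>\<^sub>F \<omega> in residual K. \<bar>u \<omega>\<bar> \<noteq> \<infinity> \<and> \<bar>v \<omega>\<bar> \<noteq> \<infinity>"
    using cinf_residual_finite[OF assms(1)] cinf_residual_finite[OF assms(2)]
    by eventually_elim simp
  have \<phi>: "continuous_map (subtopology K ?U) euclidean (\<lambda>\<omega>. real_of_ereal (u \<omega>) + real_of_ereal (v \<omega>))"
    by (intro continuous_map_add continuous_map_real_of_ereal uv) simp_all
  have "u \<omega> + v \<omega> = ereal (real_of_ereal (u \<omega>) + real_of_ereal (v \<omega>))"
    if "\<bar>u \<omega>\<bar> \<noteq> \<infinity> \<and> \<bar>v \<omega>\<bar> \<noteq> \<infinity>" for \<omega>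
    using that by (cases "u \<omega>"; cases "v \<omega>") auto
  from theI'[OF cinf_extension[OF U ev \<phi> this]]
  have *: "cadd K u v \<in> cinf K \<and>
      (\<forall>\<omega>\<in>topspace K. \<bar>u \<omega>\<bar> \<noteq> \<infinity> \<and> \<bar>v \<omega>\<bar> \<noteq> \<infinity> \<longrightarrow> cadd K u v \<omega> = u \<omega> + v \<omega>)"
    unfolding cadd_def[symmetric] by simp
  then show "cadd K u v \<in> cinf K"
    "\<And>\<omega>. \<omega> \<in> topspace K \<Longrightarrow> \<bar>u \<omega>\<bar> \<noteq> \<infinity> \<Longrightarrow> \<bar>v \<omega>\<bar> \<noteq> \<infinity> \<Longrightarrow> cadd K u v \<omega> = u \<omega> + v \<omega>" by simp_all
  show "\<forall>\<^sub>F \<omega> in residual K. cadd K u v \<omega> = u \<omega> + v \<omega>"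
    using eventually_residual_topspace ev by eventually_elim (use * in simp)
qed

lemma cminus_props:
  assumes "u \<in> cinf K" "v \<in> cinf K"
  shows "cminus K u v \<in> cinf K"
    and "\<And>\<omega>. \<omega> \<in> topspace K \<Longrightarrow> \<bar>u \<omega>\<bar> \<noteq> \<infinity> \<Longrightarrow> \<bar>v \<omega>\<bar> \<noteq> \<infinity> \<Longrightarrow> cminus K u v \<omega> = u \<omega> - v \<omega>"
    and "\<forall>\<^sub>F \<omega> in residual K. cminus K u v \<omega> = u \<omega> - v \<omega>"
proof -
  note s = cscale_props[OF assms(2), where c = "-1"]
  note a = cadd_props[OF assms(1) s(1)]
  show "cminus K u v \<in> cinf K" unfolding cminus_def by (rule a(1))
  show *: "cminus K u v \<omega> = u \<omega> - v \<omega>"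
    if "\<omega> \<in> topspace K" "\<bar>u \<omega>\<bar> \<noteq> \<infinity>" "\<bar>v \<omega>\<bar> \<noteq> \<infinity>" for \<omega>
    using that a(2)[of \<omega>] s(2)[of \<omega>] by (auto simp: cminus_def minus_ereal_def)
  show "\<forall>\<^sub>F \<omega> in residual K. cminus K u v \<omega> = u \<omega> - v \<omega>"
    using cinf_residual_finite[OF assms(1)] cinf_residual_finite[OF assms(2)]
    by eventually_elim (use * in auto)
qed

lemma clopen_indicator_cinf:
  assumes "openin K C" "closedin K C"
  shows "(\<lambda>\<omega>. if \<omega> \<in> C then 1 else 0 :: ereal) \<in> cinf K"
proof (rule cinfI)
  show "continuous_map K euclidean (\<lambda>\<omega>. if \<omega> \<in> C then 1 else 0 :: ereal)"
    by (rule continuous_map_paste[OF assms]) auto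
qed (use openin_subset[OF assms(1)] in \<open>auto simp: extensional_on_def\<close>)

end

definition cind :: "'a set \<Rightarrow> 'a \<Rightarrow> ereal" where
  "cind C = (\<lambda>\<omega>. if \<omega> \<in> C then 1 else 0)"

lemma (in stone_space) clopen_closure:
  assumes "openin K U"
  shows "openin K (K closure_of U)" "closedin K (K closure_of U)"
  using extremally_disconnected[OF assms] by simp_all

section \<open>Bands of E and projections of the unit\<close>

locale daniell_integral = stone_space +
  fixes E :: "('a \<Rightarrow> ereal) set" and X :: "'a \<Rightarrow> ereal"
  assumes ideal: "is_ideal_in K (cinf K) E"
    and unit: "cone K \<in> E"
    and X: "X \<in> E"
begin

lemma E_cinf: "u \<in> E \<Longrightarrow> u \<in> cinf K"
  and E_czero: "czero \<in> E"
  and E_cadd: "u \<in> E \<Longrightarrow> v \<in> E \<Longrightarrow> cadd K u v \<in> E"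
  and E_cscale: "u \<in> E \<Longrightarrow> cscale K c u \<in> E"
  and E_solid: "u \<in> cinf K \<Longrightarrow> v \<in> E \<Longrightarrow> cle K (cabs u) (cabs v) \<Longrightarrow> u \<in> E"
  using ideal unfolding is_ideal_in_def by blast+

lemma E_cminus: "u \<in> E \<Longrightarrow> v \<in> E \<Longrightarrow> cminus K u v \<in> E"
  unfolding cminus_def by (intro E_cadd E_cscale)

lemma E_continuous: "u \<in> E \<Longrightarrow> continuous_map K euclidean u"
  and E_extensional: "u \<in> E \<Longrightarrow> extensional_on K u"
  using E_cinf by (auto simp: cinf_def)

lemma E_cle_antisym: "u \<in> E \<Longrightarrow> v \<in> E \<Longrightarrow> cle K u v \<Longrightarrow> cle K v u \<Longrightarrow> u = v"
  using E_extensional[of u] E_extensional[of v]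
  by (intro ext) (metis antisym cle_def extensional_on_def)

text \<open>The indicator is dominated by the unit, so solidity of the ideal applies.\<close>

lemma cind_E:
  assumes "openin K C" "closedin K C"
  shows "cind C \<in> E"
proof -
  have "cind C \<in> cinf K"
    using clopen_indicator_cinf[OF assms] by (simp add: cind_def)
  then show ?thesis
    by (rule E_solid[OF _ unit]) (simp add: cle_def cabs_def cind_def cone_def)
qed

text \<open>The empty set has to be treated separately: its supremum would be a least element of \<open>E\<close>.\<close>

lemma support_band:
  assumes C: "openin K C" "closedin K C"
  shows "is_band_in K E {w\<in>E. \<forall>\<omega>\<in>topspace K - C. w \<omega> = 0}" (is "is_band_in K E ?B")
  unfolding is_band_in_def is_ideal_in_def
proof (intro conjI allI ballI impI)
  show "?B \<subseteq> E" "czero \<in> ?B" using E_czero by (auto simp: czero_def)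
  show "cadd K u v \<in> ?B" if "u \<in> ?B" "v \<in> ?B" for u v
    using that E_cadd cadd_props(2)[of u v] E_cinf by simp
  show "cscale K c u \<in> ?B" if "u \<in> ?B" for c u
    using that E_cscale cscale_props(2)[of u] E_cinf by simp
  show "u \<in> ?B" if "u \<in> E" "v \<in> ?B" "cle K (cabs u) (cabs v)" for u v
  proof -
    have "u \<omega> = 0" if "\<omega> \<in> topspace K - C" for \<omega>
    proof -
      have v0: "v \<omega> = 0" using that \<open>v \<in> ?B\<close> by blast
      have "\<bar>u \<omega>\<bar> \<le> \<bar>v \<omega>\<bar>" using that \<open>cle K (cabs u) (cabs v)\<close>
        by (simp add: cle_def cabs_def)
      then show ?thesis unfolding v0 by (cases "u \<omega>") auto
    qed
    then show ?thesis using \<open>u \<in> E\<close> by blast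
  qed
  fix D s assume D: "D \<subseteq> ?B \<and> is_lub_in K E D s"
  then have sE: "s \<in> E" and ub: "\<And>d. d \<in> D \<Longrightarrow> cle K d s"
    and least: "\<And>u. u \<in> E \<Longrightarrow> (\<And>d. d \<in> D \<Longrightarrow> cle K d u) \<Longrightarrow> cle K s u"
    by (auto simp: is_lub_in_def)
  show "s \<in> ?B"
  proof (cases "D = {}")
    case True
    \<comment> \<open>Comparing \<open>s\<close> with \<open>s - 1\<close> is absurd wherever
      \<open>s\<close> is finite; by Baire \<open>K\<close> is then empty and the condition off
      \<open>C\<close> is void.\<close>
    have le: "cle K s u" if "u \<in> E" for u using least that True by simp
    have "\<forall>\<^sub>F \<omega> in residual K. \<omega> \<notin> topspace K"
      using cinf_residual_finite[OF E_cinf[OF sE]] cminus_props(3)[OF E_cinf[OF sE] E_cinf[OF unit]]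
    proof eventually_elim
      case (elim \<omega>)
      have False
      proof -
        have "s \<omega> \<le> s \<omega> - 1"
          using le[OF E_cminus[OF sE unit]] elim unfolding cle_def by (metis cone_def)
        then show False using elim by (cases "s \<omega>") (auto simp: one_ereal_def)
      qed
      then show ?case ..
    qed
    from residual_dense[OF compact hausdorff this] have "topspace K = {}" by simp
    then show ?thesis using sE by simp
  next
    case False
    then obtain d where d: "d \<in> D" by blast
    \<comment> \<open>Members of \<open>D\<close> vanish off \<open>C\<close>, so \<open>s\<close>
      cut down to \<open>C\<close> is still an upper bound; leastness gives \<open>s \<le> 0\<close>
      off \<open>C\<close>, and the chosen \<open>d\<close> gives \<open>s \<ge> 0\<close>
      there.\<close>
    let ?s = "\<lambda>\<omega>. if \<omega> \<in> C then s \<omega> else 0"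
    have "?s \<in> cinf K"
    proof (rule cinfI)
      show "continuous_map K euclidean ?s"
        by (rule continuous_map_paste[OF C E_continuous[OF sE]]) simp
      show "extensional_on K ?s" using E_extensional[OF sE] by (simp add: extensional_on_def)
      show "\<forall>\<^sub>F \<omega> in residual K. \<bar>?s \<omega>\<bar> \<noteq> \<infinity>"
        using cinf_residual_finite[OF E_cinf[OF sE]] by eventually_elim simp
    qed
    then have "?s \<in> E" by (rule E_solid[OF _ sE]) (simp add: cle_def cabs_def)
    then have "cle K s ?s"
    proof (rule least)
      fix d assume "d \<in> D"
      then show "cle K d ?s" using ub[of d] D by (auto simp: cle_def)
    qed
    have "s \<omega> = 0" if "\<omega> \<in> topspace K - C" for \<omega>
    proof (rule antisym)
      show "s \<omega> \<le> 0" using \<open>cle K s ?s\<close> that by (auto simp: cle_def)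
      have "d \<omega> = 0" using D d that by blast
      then show "0 \<le> s \<omega>" using ub[OF d] that by (auto simp: cle_def)
    qed
    then show ?thesis using sE by blast
  qed
qed

text \<open>The generated band need not be determined. It suffices that its members vanish off the
  closure \<open>?C\<close> of the support and that it contains the indicator of \<open>?C\<close>:
  the former makes the indicator a valid projection, both together make it the only one.\<close>

lemma P_gen_unit:
  assumes Y: "Y \<in> E" and nonneg: "\<And>\<omega>. 0 \<le> Y \<omega>"
  shows "P_gen K E Y (cone K) = cind (K closure_of {\<omega>\<in>topspace K. 0 < Y \<omega>})"
proof -
  let ?U = "{\<omega>\<in>topspace K. 0 < Y \<omega>}"
  let ?C = "K closure_of ?U"
  have U: "openin K ?U" by (rule openin_continuous_map_less) (use E_continuous[OF Y] in simp_all)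
  note C = clopen_closure[OF U]
  have UC: "?U \<subseteq> ?C" by (rule closure_of_subset) blast
  have off: "Y \<omega> = 0" if "\<omega> \<in> topspace K - ?C" for \<omega>
    using that UC nonneg[of \<omega>] by (auto simp: order.order_iff_strict)
  let ?b = "cind ?C"
  have bE: "?b \<in> E" by (rule cind_E[OF C])
  have gen_sub: "w \<omega> = 0" if "w \<in> band_gen K E Y" "\<omega> \<in> topspace K - ?C" for w \<omega>
    using that support_band[OF C] Y off unfolding band_gen_def by blast
  have gen_E: "w \<in> E" if "w \<in> band_gen K E Y" for w
    using that support_band[OF C] Y off unfolding band_gen_def by blast
  \<comment> \<open>The indicator of \<open>cl {Y > 0}\<close> is the supremum of the functions \<open>min (n Y) 1\<close>.\<close>
  have b_gen: "?b \<in> band_gen K E Y"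
    unfolding band_gen_def
  proof (intro InterI, clarify)
    fix B assume B: "is_band_in K E B" and YB: "Y \<in> B"
    define d where "d n = (\<lambda>\<omega>. min (cscale K (real n) Y \<omega>) (?b \<omega>))" for n
    have nY: "cscale K (real n) Y \<in> B" for n
      using B YB by (simp add: is_band_in_def is_ideal_in_def)
    have nYE: "cscale K (real n) Y \<in> E" for n by (rule E_cscale[OF Y])
    have nYev: "\<forall>\<^sub>F \<omega> in residual K. cscale K (real n) Y \<omega> = ereal (real n) * Y \<omega>" for n
      by (rule cscale_props(3)[OF E_cinf[OF Y]])
    \<comment> \<open>Where \<open>Y\<close> is infinite the multiple is fixed only by continuity,
      so positivity is checked off a meagre set first.\<close>
    have "cle K czero (cscale K (real n) Y)" for n
    proof (rule cle_residual)
      show "\<forall>\<^sub>F \<omega> in residual K. czero \<omega> \<le> cscale K (real n) Y \<omega>"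
        using nYev[of n] by eventually_elim (use nonneg in \<open>simp add: czero_def\<close>)
    qed (use E_continuous nYE E_czero in blast)+
    then have nY0: "0 \<le> cscale K (real n) Y \<omega>" if "\<omega> \<in> topspace K" for n \<omega>
      using that by (simp add: cle_def czero_def)
    have dcont: "continuous_map K euclidean (d n)" for n
      unfolding d_def by (intro continuous_map_ereal_max_min(2) E_continuous nYE bE)
    have d01: "0 \<le> d n \<omega> \<and> d n \<omega> \<le> ?b \<omega> \<and> d n \<omega> \<le> cscale K (real n) Y \<omega>" if "\<omega> \<in> topspace K" for n \<omega>
      using nY0[OF that] by (simp add: d_def cind_def)
    have b01: "0 \<le> ?b \<omega> \<and> ?b \<omega> \<le> 1" for \<omega> by (simp add: cind_def)
    have dcinf: "d n \<in> cinf K" for n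
    proof (rule cinfI[OF dcont])
      show "extensional_on K (d n)"
        using E_extensional[OF nYE] E_extensional[OF bE] by (simp add: extensional_on_def d_def)
      show "\<forall>\<^sub>F \<omega> in residual K. \<bar>d n \<omega>\<bar> \<noteq> \<infinity>"
        using eventually_residual_topspace
      proof eventually_elim
        case (elim \<omega>)
        then show ?case using d01[OF elim, of n] b01[of \<omega>] by (cases "d n \<omega>") auto
      qed
    qed
    have dE: "d n \<in> E" for n
      by (rule E_solid[OF dcinf bE]) (use d01 b01 in \<open>simp add: cle_def cabs_def\<close>)
    have "cle K (cabs (d n)) (cabs (cscale K (real n) Y))" for n
      using d01 nY0 by (simp add: cle_def cabs_def)
    then have dB: "d n \<in> B" for n
      using B dE nY unfolding is_band_in_def is_ideal_in_def by blast
    have "is_lub_in K E (range d) ?b"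
      unfolding is_lub_in_def
    proof (intro conjI ballI impI)
      show "?b \<in> E" by (rule bE)
      show "cle K e ?b" if "e \<in> range d" for e using that d01 by (auto simp: cle_def)
      fix u assume u: "u \<in> E" "\<forall>e\<in>range d. cle K e u"
      show "cle K ?b u"
      \<comment> \<open>The pointwise supremum of the \<open>d n\<close> is 1 on \<open>?U\<close>
        but may be 0 on the boundary of \<open>?U\<close>, where \<open>?b\<close> is 1; that
        boundary is discarded.\<close>
      proof (rule cle_residual[OF E_continuous[OF bE] E_continuous[OF u(1)]])
        have "\<forall>\<^sub>F \<omega> in residual K. \<forall>n\<in>UNIV. cscale K (real n) Y \<omega> = ereal (real n) * Y \<omega>"
          by (rule eventually_residual_all_countable) (use nYev in auto)
        then show "\<forall>\<^sub>F \<omega> in residual K. ?b \<omega> \<le> u \<omega>"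
          using eventually_residual_closure_imp[OF U] eventually_residual_topspace
            cinf_residual_finite[OF E_cinf[OF Y]]
        proof eventually_elim
          case (elim \<omega>)
          have du: "d n \<omega> \<le> u \<omega>" for n using u(2) elim(3) by (simp add: cle_def)
          show ?case
          proof (cases "\<omega> \<in> ?C")
            case True
            then have "0 < Y \<omega>" using elim(2) by blast
            then obtain y where y: "Y \<omega> = ereal y" "0 < y" using elim(4) by (cases "Y \<omega>") auto
            obtain n where "1 / y \<le> real n" using real_arch_simple by blast
            then have "1 \<le> real n * y" using y(2) by (simp add: field_simps)
            then have "1 \<le> cscale K (real n) Y \<omega>" using elim(1) y by (simp add: one_ereal_def)
            then have "d n \<omega> = ?b \<omega>" using True by (simp add: d_def cind_def min_def)
            then show ?thesis using du[of n] by simp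
          next
            case False
            then have "?b \<omega> = 0" by (simp add: cind_def)
            then show ?thesis using order.trans[OF _ du[of 0]] d01[OF elim(3), of 0] by simp
          qed
        qed
      qed
    qed
    then show "?b \<in> B" using B dB unfolding is_band_in_def by blast
  qed
  have cone_b: "cminus K (cone K) w \<omega> = 1 - w \<omega>" if "w \<in> E" "\<omega> \<in> topspace K" "\<bar>w \<omega>\<bar> \<noteq> \<infinity>" for w \<omega>
    using cminus_props(2)[OF E_cinf[OF unit] E_cinf[OF that(1)] that(2) _ that(3)] that(2)
    by (simp add: cone_def)
  show ?thesis
    unfolding P_gen_def band_proj_def
  proof (rule the_equality)
    have "cdisj K (cminus K (cone K) ?b) w" if w: "w \<in> band_gen K E Y" for w
      unfolding cdisj_def
    proof
      fix \<omega> assume \<omega>: "\<omega> \<in> topspace K"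
      have m: "cminus K (cone K) ?b \<omega> = 1 - ?b \<omega>"
        by (rule cone_b[OF bE \<omega>]) (simp add: cind_def)
      show "min \<bar>cminus K (cone K) ?b \<omega>\<bar> \<bar>w \<omega>\<bar> = 0"
      proof (cases "\<omega> \<in> ?C")
        case True
        then have "\<bar>cminus K (cone K) ?b \<omega>\<bar> = 0" unfolding m by (simp add: cind_def one_ereal_def)
        then show ?thesis by (simp add: min_def)
      next
        case False
        then have "w \<omega> = 0" using gen_sub[OF w] \<omega> by blast
        then show ?thesis by (simp add: min.absorb2)
      qed
    qed
    then show "?b \<in> band_gen K E Y \<and> cminus K (cone K) ?b \<in> dcompl K E (band_gen K E Y)"
      using b_gen E_cminus[OF unit bE] by (simp add: dcompl_def)
  next
    fix b assume b: "b \<in> band_gen K E Y \<and> cminus K (cone K) b \<in> dcompl K E (band_gen K E Y)"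
    then have "b \<in> E" using gen_E by blast
    \<comment> \<open>Testing disjointness against \<open>?b\<close> itself forces
      \<open>b = 1\<close> on \<open>?C\<close>; off \<open>?C\<close> every member of the band is
      0.\<close>
    have dis: "cdisj K (cminus K (cone K) b) ?b" using b b_gen by (simp add: dcompl_def)
    show "b = ?b"
    proof (rule cinf_eqI[OF E_cinf[OF \<open>b \<in> E\<close>] E_cinf[OF bE]])
      show "\<forall>\<^sub>F \<omega> in residual K. b \<omega> = ?b \<omega>"
        using cinf_residual_finite[OF E_cinf[OF \<open>b \<in> E\<close>]]
      proof eventually_elim
        case (elim \<omega>)
        show ?case
        proof (cases "\<omega> \<in> ?C")
          case True
          have "min \<bar>cminus K (cone K) b \<omega>\<bar> \<bar>?b \<omega>\<bar> = 0"
            using dis elim unfolding cdisj_def by blast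
          moreover have "cminus K (cone K) b \<omega> = 1 - b \<omega>" "?b \<omega> = 1"
            using cone_b[OF \<open>b \<in> E\<close>] elim True by (simp_all add: cind_def)
          ultimately have "min \<bar>1 - b \<omega>\<bar> 1 = 0" by simp
          then have "\<bar>1 - b \<omega>\<bar> = 0" by (simp add: min_def split: if_splits)
          then have "b \<omega> = 1" using elim by (cases "b \<omega>") (auto simp: one_ereal_def)
          then show ?thesis using True by (simp add: cind_def)
        next
          case False
          then have "b \<omega> = 0" using gen_sub b elim by blast
          then show ?thesis using False by (simp add: cind_def)
        qed
      qed
    qed
  qed
qed

section \<open>The spectral system\<close>

lemma spec_props:
  shows "spec K E X t \<in> E"
    and "\<forall>\<^sub>F \<omega> in residual K. spec K E X t \<omega> = ereal (indicator {..t} (real_of_ereal (X \<omega>)))"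
proof -
  define Z where "Z = cminus K X (cscale K t (cone K))"
  let ?Y = "cpos Z"
  let ?U = "{\<omega>\<in>topspace K. 0 < ?Y \<omega>}"
  have ZE: "Z \<in> E" unfolding Z_def by (intro E_cminus X E_cscale unit)
  have "continuous_map K euclidean ?Y"
    unfolding cpos_def by (intro continuous_map_ereal_max_min(1) E_continuous[OF ZE]) simp
  moreover have "\<forall>\<^sub>F \<omega> in residual K. \<bar>?Y \<omega>\<bar> \<noteq> \<infinity>"
    using cinf_residual_finite[OF E_cinf[OF ZE]] by eventually_elim (auto simp: cpos_def max_def)
  ultimately have "?Y \<in> cinf K"
    using E_extensional[OF ZE] by (intro cinfI) (simp_all add: extensional_on_def cpos_def)
  then have YE: "?Y \<in> E"
    by (rule E_solid[OF _ ZE]) (simp add: cle_def cabs_def cpos_def max_def)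
  \<comment> \<open>The positive part of \<open>X - t\<close> is positive exactly where
    \<open>X > t\<close>, so the projection is the indicator of the closure of
    \<open>{X > t}\<close>; dropping the boundary then leaves the complement of
    \<open>{X > t}\<close>.\<close>
  have eq: "spec K E X t = cminus K (cone K) (cind (K closure_of ?U))"
    unfolding spec_def Z_def[symmetric] using P_gen_unit[OF YE] by (simp add: cpos_def)
  have U: "openin K ?U" by (rule openin_continuous_map_less) (use E_continuous[OF YE] in simp_all)
  have iE: "cind (K closure_of ?U) \<in> E" by (rule cind_E[OF clopen_closure[OF U]])
  show "spec K E X t \<in> E" unfolding eq by (rule E_cminus[OF unit iE])
  show "\<forall>\<^sub>F \<omega> in residual K. spec K E X t \<omega> = ereal (indicator {..t} (real_of_ereal (X \<omega>)))"
    using cinf_residual_finite[OF E_cinf[OF X]] eventually_residual_closure_imp[OF U]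
      cminus_props(3)[OF E_cinf[OF X] E_cinf[OF E_cscale[OF unit, where c = t]]]
      cscale_props(3)[OF E_cinf[OF unit], where c = t]
      cminus_props(3)[OF E_cinf[OF unit] E_cinf[OF iE]]
  proof eventually_elim
    case (elim \<omega>)
    have cl: "\<omega> \<in> K closure_of ?U \<longleftrightarrow> \<omega> \<in> ?U"
      using elim(2) closure_of_subset[OF openin_subset[OF U]] by blast
    obtain x where x: "X \<omega> = ereal x" using elim(1) by (cases "X \<omega>") auto
    have "Z \<omega> = ereal (x - t)" using elim x by (simp add: Z_def cone_def)
    then have "\<omega> \<in> ?U \<longleftrightarrow> t < x" using elim(1) by (simp add: cpos_def less_max_iff_disj)
    then show ?case using elim(1,5) cl x by (simp add: eq cone_def cind_def one_ereal_def indicator_def)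
  qed
qed

lemma lub_in_eq: "is_lub_in K E B z \<Longrightarrow> lub_in K E B = z"
  unfolding lub_in_def by (rule the_equality) (auto simp: is_lub_in_def intro: E_cle_antisym)

lemma glb_in_eq: "is_glb_in K E B z \<Longrightarrow> glb_in K E B = z"
  unfolding glb_in_def by (rule the_equality) (auto simp: is_glb_in_def intro: E_cle_antisym)

lemma spec_bounds:
  shows "cle K czero (spec K E X t)" and "cle K (spec K E X t) (cone K)"
proof -
  note cont = E_continuous[OF spec_props(1)] E_continuous[OF unit] E_continuous[OF E_czero]
  show "cle K czero (spec K E X t)"
    by (rule cle_residual[OF cont(3,1)], rule eventually_mono[OF spec_props(2)[of t]])
      (simp add: czero_def)
  have "\<forall>\<^sub>F \<omega> in residual K. spec K E X t \<omega> \<le> cone K \<omega>"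
    using spec_props(2)[of t] eventually_residual_topspace
    by eventually_elim (simp add: cone_def indicator_def one_ereal_def)
  then show "cle K (spec K E X t) (cone K)" by (rule cle_residual[OF cont(1,2)])
qed

text \<open>The exceptional set depends on \<open>q\<close>, so only countably many levels can be
  treated at once; the integer levels are enough for the two limits of the system.\<close>

lemma spec_residual_all:
  "\<forall>\<^sub>F \<omega> in residual K. \<forall>q\<in>\<rat>. spec K E X q \<omega> = ereal (indicator {..q} (real_of_ereal (X \<omega>)))"
  by (rule eventually_residual_all_countable[OF countable_rat spec_props(2)])

text \<open>Off a meagre set the system reaches 1 along the natural numbers by the Archimedean
  property, so every upper bound in \<open>E\<close> lies above the unit.\<close>

lemma spec_top_eq: "spec_top K E X = cone K"
  unfolding spec_top_def
proof (rule lub_in_eq, unfold is_lub_in_def, intro conjI ballI impI)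
  fix u assume u: "u \<in> E" "\<forall>b\<in>range (spec K E X). cle K b u"
  have "\<forall>\<^sub>F \<omega> in residual K. cone K \<omega> \<le> u \<omega>"
    using spec_residual_all eventually_residual_topspace
  proof eventually_elim
    case (elim \<omega>)
    obtain n where "real_of_ereal (X \<omega>) \<le> real n" using real_arch_simple by blast
    then have "spec K E X (real n) \<omega> = 1" using elim by (simp add: one_ereal_def)
    moreover have "spec K E X (real n) \<omega> \<le> u \<omega>" using u(2) elim(2) by (simp add: cle_def)
    ultimately show ?case using elim(2) by (simp add: cone_def)
  qed
  then show "cle K (cone K) u" by (rule cle_residual[OF E_continuous[OF unit] E_continuous[OF u(1)]])
qed (use unit spec_bounds in auto)

lemma spec_bot_eq: "spec_bot K E X = czero"
  unfolding spec_bot_def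
proof (rule glb_in_eq, unfold is_glb_in_def, intro conjI ballI impI)
  fix u assume u: "u \<in> E" "\<forall>b\<in>range (spec K E X). cle K u b"
  have "\<forall>\<^sub>F \<omega> in residual K. u \<omega> \<le> czero \<omega>"
    using spec_residual_all eventually_residual_topspace
  proof eventually_elim
    case (elim \<omega>)
    obtain n where "- real_of_ereal (X \<omega>) < real n" using reals_Archimedean2 by blast
    then have "spec K E X (- real n) \<omega> = 0" using elim by simp
    moreover have "u \<omega> \<le> spec K E X (- real n) \<omega>" using u(2) elim(2) by (simp add: cle_def)
    ultimately show ?case by (simp add: czero_def)
  qed
  then show "cle K u czero" by (rule cle_residual[OF E_continuous[OF u(1)] E_continuous[OF E_czero]])
qed (use E_czero spec_bounds in auto)

section \<open>The Daniell integral as composition with \<open>X\<close>\<close>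

text \<open>Every case is a difference of indicators of closed rays, where \<open>spec_top\<close>
  and \<open>spec_bot\<close> count as the constants 1 and 0; for \<open>OC a b\<close> the
  condition \<open>a < b\<close> makes this difference an indicator.\<close>

lemma mu_ivl_props:
  assumes "ivl_ok J"
  shows "mu_ivl K E X J \<in> E"
    and "\<forall>\<^sub>F \<omega> in residual K. mu_ivl K E X J \<omega> = ereal (indicator (ivl_set J) (real_of_ereal (X \<omega>)))"
proof -
  note sE = spec_props(1)
  have d: "cminus K u v \<in> E \<and> (\<forall>\<^sub>F \<omega> in residual K. cminus K u v \<omega> = ereal (\<eta> (real_of_ereal (X \<omega>))))"
    if "u \<in> E" "v \<in> E" "\<forall>\<^sub>F \<omega> in residual K. u \<omega> = ereal (\<phi> (real_of_ereal (X \<omega>)))"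
      "\<forall>\<^sub>F \<omega> in residual K. v \<omega> = ereal (\<psi> (real_of_ereal (X \<omega>)))" "\<And>x. \<eta> x = \<phi> x - \<psi> x"
    for u v and \<phi> \<psi> \<eta> :: "real \<Rightarrow> real"
    using that(3,4) cminus_props(3)[OF E_cinf[OF that(1)] E_cinf[OF that(2)]]
    by (intro conjI E_cminus that(1,2), eventually_elim) (simp add: that(5))
  have top: "\<forall>\<^sub>F \<omega> in residual K. spec_top K E X \<omega> = ereal 1"
    using eventually_residual_topspace
    by eventually_elim (simp add: spec_top_eq cone_def one_ereal_def)
  have bot: "\<forall>\<^sub>F \<omega> in residual K. spec_bot K E X \<omega> = ereal 0"
    by (simp add: spec_bot_eq czero_def)
  have "mu_ivl K E X J \<in> E \<and>
    (\<forall>\<^sub>F \<omega> in residual K. mu_ivl K E X J \<omega> = ereal (indicator (ivl_set J) (real_of_ereal (X \<omega>))))"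
  proof (cases J)
    case (OC a b)
    then show ?thesis using assms
      by (simp, intro d[OF sE sE spec_props(2) spec_props(2)]) (auto simp: indicator_def)
  next
    case (OpenRay a)
    have "spec_top K E X \<in> E" by (simp add: spec_top_eq unit)
    then show ?thesis
      using OpenRay by (simp, intro d[OF _ sE top spec_props(2)]) (auto simp: indicator_def)
  next
    case (ClosedRay b)
    have "spec_bot K E X \<in> E" by (simp add: spec_bot_eq E_czero)
    then show ?thesis
      using ClosedRay by (simp, intro d[OF sE _ spec_props(2) bot]) (auto simp: indicator_def)
  qed
  then show "mu_ivl K E X J \<in> E"
    "\<forall>\<^sub>F \<omega> in residual K. mu_ivl K E X J \<omega> = ereal (indicator (ivl_set J) (real_of_ereal (X \<omega>)))"
    by simp_all
qed

lemma csum_props: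
  fixes \<phi> :: "'b \<Rightarrow> 'a \<Rightarrow> real"
  assumes "\<And>x. x \<in> set xs \<Longrightarrow> F x \<in> E"
    and "\<And>x. x \<in> set xs \<Longrightarrow> \<forall>\<^sub>F \<omega> in residual K. F x \<omega> = ereal (\<phi> x \<omega>)"
  shows "csum K (map F xs) \<in> E"
    and "\<forall>\<^sub>F \<omega> in residual K. csum K (map F xs) \<omega> = ereal (\<Sum>x\<leftarrow>xs. \<phi> x \<omega>)"
proof -
  have "csum K (map F xs) \<in> E \<and>
      (\<forall>\<^sub>F \<omega> in residual K. csum K (map F xs) \<omega> = ereal (\<Sum>x\<leftarrow>xs. \<phi> x \<omega>))"
    using assms
  proof (induction xs)
    case Nil
    show ?case using E_czero by (simp add: csum_def czero_def)
  next
    case (Cons a xs)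
    let ?s = "csum K (map F xs)"
    have IH: "?s \<in> E" "\<forall>\<^sub>F \<omega> in residual K. ?s \<omega> = ereal (\<Sum>x\<leftarrow>xs. \<phi> x \<omega>)"
      using Cons.IH Cons.prems by simp_all
    have a: "F a \<in> E" "\<forall>\<^sub>F \<omega> in residual K. F a \<omega> = ereal (\<phi> a \<omega>)" using Cons.prems by simp_all
    have eq: "csum K (map F (a # xs)) = cadd K (F a) ?s" by (simp add: csum_def)
    have "\<forall>\<^sub>F \<omega> in residual K. cadd K (F a) ?s \<omega> = ereal (\<Sum>x\<leftarrow>a # xs. \<phi> x \<omega>)"
      using a(2) IH(2) cadd_props(3)[OF E_cinf[OF a(1)] E_cinf[OF IH(1)]]
      by eventually_elim simp
    then show ?case unfolding eq using E_cadd[OF a(1) IH(1)] by simp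
  qed
  then show "csum K (map F xs) \<in> E"
    "\<forall>\<^sub>F \<omega> in residual K. csum K (map F xs) \<omega> = ereal (\<Sum>x\<leftarrow>xs. \<phi> x \<omega>)" by simp_all
qed

text \<open>Disjointness of the intervals turns the sum of their indicators into the indicator of
  the union.\<close>

lemma mu_fset_props:
  assumes "fset_ok Js"
  shows "mu_fset K E X Js \<in> E"
    and "\<forall>\<^sub>F \<omega> in residual K. mu_fset K E X Js \<omega> = ereal (indicator (fset_of Js) (real_of_ereal (X \<omega>)))"
proof -
  have ok: "ivl_ok J" if "J \<in> set Js" for J using assms that by (simp add: fset_ok_def)
  have sum: "(\<Sum>J\<leftarrow>Js. indicator (ivl_set J) t) = (indicator (fset_of Js) t :: real)" for t
  proof -
    have "(\<Sum>J\<leftarrow>Js. indicator (ivl_set J) t :: real) = (\<Sum>i<length Js. indicator (ivl_set (Js ! i)) t)"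
      by (simp add: sum_list_sum_nth atLeast0LessThan)
    also have "\<dots> = indicator (\<Union>i<length Js. ivl_set (Js ! i)) t"
      by (rule indicator_UN_disjoint[symmetric])
        (use assms in \<open>auto simp: fset_ok_def disjoint_family_on_def\<close>)
    also have "(\<Union>i<length Js. ivl_set (Js ! i)) = fset_of Js"
      by (fastforce simp: fset_of_def in_set_conv_nth)
    finally show ?thesis .
  qed
  have *: "\<And>J. J \<in> set Js \<Longrightarrow> mu_ivl K E X J \<in> E"
      "\<And>J. J \<in> set Js \<Longrightarrow> \<forall>\<^sub>F \<omega> in residual K. mu_ivl K E X J \<omega> = ereal (indicator (ivl_set J) (real_of_ereal (X \<omega>)))"
    using mu_ivl_props ok by blast+
  show "mu_fset K E X Js \<in> E" 
    "\<forall>\<^sub>F \<omega> in residual K. mu_fset K E X Js \<omega> = ereal (indicator (fset_of Js) (real_of_ereal (X \<omega>)))"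
    using csum_props[where F = "mu_ivl K E X" and xs = Js, OF *] unfolding mu_fset_def
    by (simp_all add: sum)
qed

text \<open>The value is expressed by \<open>f\<close> alone, so it does not depend on the chosen
  partition.\<close>

lemma daniell_L_val_props:
  assumes "daniell_L_val K E X f v"
  shows "v \<in> E" and "\<forall>\<^sub>F \<omega> in residual K. v \<omega> = ereal (f (real_of_ereal (X \<omega>)))"
proof -
  obtain ps :: "(real \<times> ivl list) list" where ok: "\<And>p. p \<in> set ps \<Longrightarrow> fset_ok (snd p)"
    and f: "f = (\<lambda>t. \<Sum>i<length ps. fst (ps!i) * indicator (fset_of (snd (ps!i))) t)"
    and v: "v = csum K (map (\<lambda>p. cscale K (fst p) (mu_fset K E X (snd p))) ps)"
    using assms unfolding daniell_L_val_def by blast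
  have f': "f t = (\<Sum>p\<leftarrow>ps. fst p * indicator (fset_of (snd p)) t)" for t
    by (simp add: f sum_list_sum_nth atLeast0LessThan)
  have 1: "cscale K (fst p) (mu_fset K E X (snd p)) \<in> E" if "p \<in> set ps" for p
    by (intro E_cscale mu_fset_props(1) ok that)
  have 2: "\<forall>\<^sub>F \<omega> in residual K. cscale K (fst p) (mu_fset K E X (snd p)) \<omega> =
      ereal (fst p * indicator (fset_of (snd p)) (real_of_ereal (X \<omega>)))" if "p \<in> set ps" for p
    using mu_fset_props(2)[OF ok[OF that]] cscale_props(3)[OF E_cinf[OF mu_fset_props(1)[OF ok[OF that]]]]
    by eventually_elim simp
  show "v \<in> E" "\<forall>\<^sub>F \<omega> in residual K. v \<omega> = ereal (f (real_of_ereal (X \<omega>)))"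
    unfolding v f' using csum_props[where F = "\<lambda>p. cscale K (fst p) (mu_fset K E X (snd p))", OF 1 2] by simp_all
qed

text \<open>On the complement of the clopen set \<open>cl (\<Union>n. {vs n > q})\<close> the function \<open>v\<close> may be replaced by \<open>min v q\<close>
  without losing an upper bound, so \<open>v \<le> q\<close> there. Hence \<open>v\<close> exceeds the pointwise supremum at most on
  the boundaries of these sets for rational \<open>q\<close>.\<close>

lemma lub_sup_compl_residual:
  fixes vs :: "nat \<Rightarrow> 'a \<Rightarrow> ereal"
  assumes vs: "\<And>n. vs n \<in> E" and lub: "is_lub_in K (sup_compl K E) (range vs) v"
  shows "\<forall>\<^sub>F \<omega> in residual K. v \<omega> = (SUP n. vs n \<omega>)"
proof -
  define W where "W q = (\<Union>n. {\<omega>\<in>topspace K. ereal q < vs n \<omega>})" for q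
  have Wo: "openin K (W q)" for q
    unfolding W_def by (intro openin_Union) (auto intro!: openin_continuous_map_less E_continuous[OF vs])
  have v: "v \<in> sup_compl K E" and ub: "\<And>n \<omega>. \<omega> \<in> topspace K \<Longrightarrow> vs n \<omega> \<le> v \<omega>"
    and least: "\<And>u. u \<in> sup_compl K E \<Longrightarrow> (\<And>n. cle K (vs n) u) \<Longrightarrow> cle K v u"
    using lub by (auto simp: is_lub_in_def cle_def)
  have vc: "continuous_map K euclidean v" "extensional_on K v"
    using v by (simp_all add: sup_compl_def)
  have bound: "v \<omega> \<le> ereal q" if "\<omega> \<in> topspace K - K closure_of W q" for \<omega> q
  proof -
    let ?C = "K closure_of W q"
    let ?u = "\<lambda>\<omega>. if \<omega> \<in> ?C then v \<omega> else if \<omega> \<in> topspace K then min (v \<omega>) (ereal q) else 0"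
    have WC: "W q \<subseteq> ?C" by (rule closure_of_subset[OF openin_subset[OF Wo]])
    have CK: "?C \<subseteq> topspace K" by (rule closure_of_subset_topspace)
    have le: "cle K (vs n) ?u" for n
      unfolding cle_def
    proof
      fix \<omega> assume \<omega>: "\<omega> \<in> topspace K"
      show "vs n \<omega> \<le> ?u \<omega>"
      proof (cases "\<omega> \<in> ?C")
        case False
        then have "\<omega> \<notin> W q" using WC by blast
        then have "vs n \<omega> \<le> ereal q" using \<omega> by (auto simp: W_def not_less)
        then show ?thesis using ub[OF \<omega>] \<omega> by simp
      qed (use ub[OF \<omega>] in simp)
    qed
    have "continuous_map K euclidean (\<lambda>\<omega>. if \<omega> \<in> ?C then v \<omega> else min (v \<omega>) (ereal q))"
      by (intro continuous_map_paste clopen_closure[OF Wo] vc continuous_map_ereal_max_min(2)) simp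
    then have "continuous_map K euclidean ?u"
      by (rule continuous_map_eq) auto
    moreover have "extensional_on K ?u" using CK by (auto simp: extensional_on_def)
    \<comment> \<open>Membership in the sup-completion asks for an element of \<open>E\<close> below
      \<open>?u\<close>; \<open>vs 0\<close> is one.\<close>
    ultimately have "?u \<in> sup_compl K E" unfolding sup_compl_def using le[of 0] vs[of 0] by blast
    then have "cle K v ?u" using le by (rule least)
    then show ?thesis using that by (auto simp: cle_def)
  qed
  have "\<forall>\<^sub>F \<omega> in residual K. \<forall>q\<in>\<rat>. \<omega> \<in> K closure_of W q \<longrightarrow> \<omega> \<in> W q"
    by (rule eventually_residual_all_countable[OF countable_rat eventually_residual_closure_imp[OF Wo]])
  then show ?thesis using eventually_residual_topspace
  proof eventually_elim
    case (elim \<omega>)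
    show ?case
    proof (rule antisym)
      show "(SUP n. vs n \<omega>) \<le> v \<omega>" by (rule SUP_least) (rule ub[OF elim(2)])
      show "v \<omega> \<le> (SUP n. vs n \<omega>)"
      proof (rule ccontr)
        assume "\<not> ?thesis"
        then have "(SUP n. vs n \<omega>) < v \<omega>" by simp
        \<comment> \<open>Both sides may be infinite, so two reals are inserted before a rational is
          chosen between them.\<close>
        then obtain r where r: "(SUP n. vs n \<omega>) < ereal r" "ereal r < v \<omega>"
          using ereal_dense2 by blast
        obtain r' where r': "ereal r < ereal r'" "ereal r' < v \<omega>" using ereal_dense2[OF r(2)] by blast
        then obtain q where q: "q \<in> \<rat>" "r < q" "q < r'" using Rats_dense_in_real[of r r'] by auto
        have "vs n \<omega> < ereal q" for n
        proof -
          have "vs n \<omega> \<le> (SUP n. vs n \<omega>)" by (rule SUP_upper) simp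
          also note r(1)
          also have "ereal r < ereal q" using q by simp
          finally show ?thesis .
        qed
        then have "\<omega> \<notin> W q" by (auto simp: W_def dest: less_asym)
        then have "\<omega> \<notin> K closure_of W q" using elim(1) q(1) by blast
        then have "v \<omega> \<le> ereal q" using bound elim(2) by blast
        also have "ereal q < ereal r'" using q by simp
        finally show False using r'(2) by simp
      qed
    qed
  qed
qed

text \<open>The exceptional sets of all \<open>vs n\<close> and of the supremum are merged. At a
  remaining point the increasing sequence tends both to its supremum and to the value of
  \<open>g\<close>, which also shows that \<open>v\<close> is finite there.\<close>

lemma daniell_up_val_residual:
  assumes "daniell_up_val K E X g v"
  shows "\<forall>\<^sub>F \<omega> in residual K. v \<omega> = ereal (g (real_of_ereal (X \<omega>)))"
proof -
  obtain fs vs where fs: "\<And>n. daniell_L_val K E X (fs n) (vs n)"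
    and conv: "\<And>t. incseq (\<lambda>n. fs n t)" "\<And>t. (\<lambda>n. fs n t) \<longlonglongrightarrow> g t"
    and lub: "is_lub_in K (sup_compl K E) (range vs) v"
    using assms unfolding daniell_up_val_def by blast
  have "\<forall>\<^sub>F \<omega> in residual K. \<forall>n\<in>UNIV. vs n \<omega> = ereal (fs n (real_of_ereal (X \<omega>)))"
    by (rule eventually_residual_all_countable) (use daniell_L_val_props(2)[OF fs] in auto)
  then show ?thesis
    using lub_sup_compl_residual[OF daniell_L_val_props(1)[OF fs] lub]
  proof eventually_elim
    case (elim \<omega>)
    let ?x = "real_of_ereal (X \<omega>)"
    have "incseq (\<lambda>n. ereal (fs n ?x))" using conv(1)[of ?x] by (simp add: incseq_def)
    then have "(\<lambda>n. ereal (fs n ?x)) \<longlonglongrightarrow> (SUP n. ereal (fs n ?x))" by (rule LIMSEQ_SUP)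
    moreover have "(\<lambda>n. ereal (fs n ?x)) \<longlonglongrightarrow> ereal (g ?x)" using conv(2) by simp
    ultimately have "(SUP n. ereal (fs n ?x)) = ereal (g ?x)" by (rule LIMSEQ_unique)
    then show ?case using elim by simp
  qed
qed

end

section \<open>Step functions and dyadic approximation from below\<close>

lemma daniell_L_val_step_function:
  fixes x c :: "nat \<Rightarrow> real"
  assumes "strict_mono x"
  shows "\<exists>v. daniell_L_val K E X (\<lambda>t. \<Sum>k<N. c k * indicator {x k<..x (Suc k)} t) v"
proof -
  \<comment> \<open>The entry with coefficient 0 consists of the two outer rays and completes the
    cells to a partition of the line, also for \<open>N = 0\<close>. It shifts the indices: cell
    \<open>k\<close> is entry \<open>Suc k\<close>.\<close>
  define ps where "ps = (0, [ClosedRay (x 0), OpenRay (x N)]) # map (\<lambda>k. (c k, [OC (x k) (x (Suc k))])) [0..<N]"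
  define S where "S i = fset_of (snd (ps ! i))" for i
  have mono: "x i \<le> x j" if "i \<le> j" for i j using assms that by (simp add: strict_mono_less_eq)
  have len: "length ps = Suc N" by (simp add: ps_def)
  have S0: "S 0 = {..x 0} \<union> {x N<..}" by (auto simp: S_def ps_def fset_of_def)
  have SS: "S (Suc k) = {x k<..x (Suc k)}" if "k < N" for k
    using that by (simp add: S_def ps_def fset_of_def)
  have disj0: "S 0 \<inter> S (Suc k) = {}" if "k < N" for k
  proof -
    have "x 0 \<le> x k" "x (Suc k) \<le> x N" using mono[of 0 k] mono[of "Suc k" N] that by simp_all
    then show ?thesis unfolding S0 SS[OF that] by auto
  qed
  have disjS: "S (Suc k) \<inter> S (Suc l) = {}" if "k < l" "l < N" for k l
    using mono[of "Suc k" l] that SS[of k] SS[of l] by auto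
  have disj: "S i \<inter> S j = {}" if "i < Suc N" "j < Suc N" "i \<noteq> j" for i j
  proof (cases i)
    case 0
    then show ?thesis using that disj0 by (cases j) auto
  next
    case i: (Suc k)
    show ?thesis
    proof (cases j)
      case 0
      then show ?thesis using i that disj0[of k] by auto
    next
      case j: (Suc l)
      show ?thesis
      proof (cases "k < l")
        case True
        then show ?thesis using disjS i j that by simp
      next
        case False
        then have "l < k" using i j that by simp
        then show ?thesis using disjS[of l k] i j that by (simp add: Int_commute)
      qed
    qed
  qed
  have cells: "(\<Union>k<m. {x k<..x (Suc k)}) = {x 0<..x m}" for m
  proof (induction m)
    case (Suc m)
    have "x 0 \<le> x m" "x m \<le> x (Suc m)" using mono[of 0 m] mono[of m "Suc m"] by simp_all
    then show ?case using Suc by (auto simp: lessThan_Suc)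
  qed simp
  have ok: "\<forall>p\<in>set ps. fset_ok (snd p)"
    using assms mono[of 0 N]
    by (auto simp: ps_def fset_ok_def strict_mono_Suc_iff less_Suc_eq)
  have "(\<Union>p\<in>set ps. fset_of (snd p)) = {..x 0} \<union> {x N<..} \<union> (\<Union>k<N. {x k<..x (Suc k)})"
    by (auto simp: ps_def fset_of_def)
  also have "\<dots> = UNIV" unfolding cells by auto
  finally have un: "(\<Union>p\<in>set ps. fset_of (snd p)) = UNIV" .
  have sum: "(\<Sum>k<N. c k * indicator {x k<..x (Suc k)} t) =
      (\<Sum>i<length ps. fst (ps!i) * indicator (fset_of (snd (ps!i))) t)" for t
    unfolding len S_def[symmetric] sum.lessThan_Suc_shift
    by (simp add: SS) (simp add: ps_def)
  show ?thesis
    unfolding daniell_L_val_def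
    by (intro exI conjI, rule ok, use disj len in \<open>simp add: S_def\<close>, rule un, rule ext, rule sum, rule refl)
qed

text \<open>On the dyadic cells of length \<open>2 ^ - n\<close> inside \<open>(-n, n]\<close> take the infimum over the closed cell.\<close>

lemma continuous_step_approximation:
  fixes g :: "real \<Rightarrow> real"
  assumes g: "continuous_on UNIV g" and nonneg: "\<And>t. 0 \<le> g t"
  obtains s :: "nat \<Rightarrow> real \<Rightarrow> real" where
    "\<And>n. \<exists>x c N. strict_mono x \<and> s n = (\<lambda>t. \<Sum>k<N. c k * indicator {x k<..x (Suc k)} t)"
    "\<And>t. incseq (\<lambda>n. s n t)" "\<And>t. (\<lambda>n. s n t) \<longlonglongrightarrow> g t"
proof
  \<comment> \<open>The ceiling puts \<open>t\<close> into a cell open on the left and closed on the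
    right, the shape of the intervals \<open>OC\<close>.\<close>
  define cell :: "nat \<Rightarrow> real \<Rightarrow> real set"
    where "cell n t = {(of_int \<lceil>2 ^ n * t\<rceil> - 1) / 2 ^ n .. of_int \<lceil>2 ^ n * t\<rceil> / 2 ^ n}" for n t
  define s where "s n t = (if - real n < t \<and> t \<le> real n then Inf (g ` cell n t) else 0)" for n t
  have bdd: "bdd_below (g ` A)" for A using nonneg by (intro bdd_belowI[of _ 0]) auto
  have mem: "t \<in> cell n t" for n t
    using ceiling_correct[of "2 ^ n * t"] by (auto simp: cell_def field_simps)
  have cell_mono: "cell (Suc n) t \<subseteq> cell n t" for n t
  proof -
    let ?m = "\<lceil>2 ^ n * t\<rceil>" and ?M = "\<lceil>2 ^ Suc n * t\<rceil>"
    \<comment> \<open>Halving a cell leaves two possibilities, \<open>?M = 2 * ?m - 1\<close> or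
      \<open>?M = 2 * ?m\<close>, and both subcells lie in the old cell.\<close>
    have "?M \<le> 2 * ?m"
      unfolding ceiling_le_iff using ceiling_correct[of "2 ^ n * t"] by (simp add: mult.assoc)
    then have M1: "real_of_int ?M \<le> 2 * real_of_int ?m" by linarith
    have "2 * ?m - 2 < ?M"
      unfolding less_ceiling_iff using ceiling_correct[of "2 ^ n * t"] by (simp add: mult.assoc)
    then have M2: "2 * real_of_int ?m - 1 \<le> real_of_int ?M" by linarith
    show ?thesis
      unfolding cell_def
    proof (rule atLeastatMost_subset_iff[THEN iffD2], intro disjI2 conjI)
      show "(real_of_int ?m - 1) / 2 ^ n \<le> (real_of_int ?M - 1) / 2 ^ Suc n"
      proof -
        have "(real_of_int ?m - 1) / 2 ^ n = (2 * real_of_int ?m - 2) / 2 ^ Suc n"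
          by (simp add: field_simps)
        also have "\<dots> \<le> (real_of_int ?M - 1) / 2 ^ Suc n"
          using M2 by (intro divide_right_mono) simp_all
        finally show ?thesis .
      qed
      show "real_of_int ?M / 2 ^ Suc n \<le> real_of_int ?m / 2 ^ n"
        using M1 by (simp add: field_simps)
    qed
  qed
  have Inf0: "0 \<le> Inf (g ` cell n t)" for n t
    using mem[of t n] nonneg by (intro cInf_greatest) auto
  have Infle: "Inf (g ` cell n t) \<le> g t" for n t
    using mem[of t n] bdd by (intro cInf_lower) auto
  show "incseq (\<lambda>n. s n t)" for t
  proof (rule incseq_SucI)
    fix n
    have "Inf (g ` cell n t) \<le> Inf (g ` cell (Suc n) t)"
      using mem[of t "Suc n"] cell_mono[of n t] bdd by (intro cInf_superset_mono) auto
    \<comment> \<open>Points that enter the window only at stage \<open>Suc n\<close> jump from 0 to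
      an infimum, which is nonnegative because \<open>g\<close> is.\<close>
    then show "s n t \<le> s (Suc n) t" using Inf0[of "Suc n" t] by (auto simp: s_def)
  qed
  show "(\<lambda>n. s n t) \<longlonglongrightarrow> g t" for t
  proof (rule LIMSEQ_I)
    fix r :: real assume "0 < r"
    \<comment> \<open>The infimum over a cell only inherits a weak inequality; \<open>r / 2\<close>
      keeps the final one strict.\<close>
    then obtain d where d: "0 < d" "\<And>y. \<bar>y - t\<bar> < d \<Longrightarrow> \<bar>g y - g t\<bar> < r / 2"
      using g[unfolded continuous_on_iff, rule_format, of t "r / 2"] by (auto simp: dist_real_def)
    obtain n0 where n0: "(1 / 2) ^ n0 < d" using real_arch_pow_inv[of d "1 / 2"] d(1) by auto
    obtain n1 where n1: "\<bar>t\<bar> < real n1" using reals_Archimedean2 by blast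
    show "\<exists>no. \<forall>n\<ge>no. norm (s n t - g t) < r"
    proof (intro exI[of _ "max n0 n1"] allI impI)
      fix n assume n: "max n0 n1 \<le> n"
      have "(1 / 2 :: real) ^ n \<le> (1 / 2) ^ n0" using n by (intro power_decreasing) auto
      then have small: "1 / 2 ^ n < d" using n0 by (simp add: power_one_over)
      have "g t - r / 2 \<le> Inf (g ` cell n t)"
      proof (rule cInf_greatest)
        fix z assume "z \<in> g ` cell n t"
        then obtain y where y: "y \<in> cell n t" "z = g y" by blast
        have "\<bar>y - t\<bar> \<le> 1 / 2 ^ n"
          using y(1) mem[of t n] unfolding cell_def diff_divide_distrib by auto
        then have "\<bar>g y - g t\<bar> < r / 2" using small d(2) by simp
        then show "g t - r / 2 \<le> z" using y(2) by linarith
      qed (use mem[of t n] in auto)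
      moreover have "- real n < t \<and> t \<le> real n" using n n1 by linarith
      then have "s n t = Inf (g ` cell n t)" by (simp add: s_def)
      ultimately show "norm (s n t - g t) < r" using Infle[of n t] \<open>0 < r\<close> by (simp add: abs_if)
    qed
  qed
  show "\<exists>x c N. strict_mono x \<and> s n = (\<lambda>t. \<Sum>k<N. c k * indicator {x k<..x (Suc k)} t)" for n
  proof -
    \<comment> \<open>The grid of step \<open>1 / 2 ^ n\<close> starts at \<open>-n\<close> and
      reaches \<open>n\<close> after \<open>N\<close> cells.\<close>
    define x where "x k = real k / 2 ^ n - real n" for k
    define c where "c k = Inf (g ` {x k..x (Suc k)})" for k
    define N where "N = 2 * n * 2 ^ n"
    have "strict_mono x" by (auto simp: strict_mono_Suc_iff x_def divide_strict_right_mono)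
    moreover have "s n t = (\<Sum>k<N. c k * indicator {x k<..x (Suc k)} t)" for t
    proof -
      \<comment> \<open>This is the index of the cell containing \<open>t\<close>: the right end of
        cell \<open>k\<close> is \<open>(k + 1) / 2 ^ n - n\<close>, hence the shift by
        \<open>n * 2 ^ n\<close> and by one.\<close>
      define j where "j = \<lceil>2 ^ n * t\<rceil> - 1 + int n * 2 ^ n"
      have cl: "real_of_int \<lceil>2 ^ n * t\<rceil> = real_of_int j + 1 - real n * 2 ^ n" by (simp add: j_def)
      have inx: "t \<in> {x k<..x (Suc k)} \<longleftrightarrow> int k = j" for k
      proof -
        have "t \<in> {x k<..x (Suc k)} \<longleftrightarrow> real k - real n * 2 ^ n < 2 ^ n * t \<and> 2 ^ n * t \<le> real k + 1 - real n * 2 ^ n"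
          by (simp add: x_def field_simps)
        also have "\<dots> \<longleftrightarrow> \<lceil>2 ^ n * t\<rceil> = int k + 1 - int n * 2 ^ n"
          unfolding ceiling_eq_iff by (simp add: algebra_simps)
        also have "\<dots> \<longleftrightarrow> int k = j" by (auto simp: j_def)
        finally show ?thesis .
      qed
      have lo: "- real n < t \<longleftrightarrow> 0 \<le> j"
      proof -
        have "- real n < t \<longleftrightarrow> real_of_int (- int n * 2 ^ n) < 2 ^ n * t"
          using mult_less_cancel_right_pos[of "2 ^ n" "- real n" t] by (simp add: mult.commute)
        also have "\<dots> \<longleftrightarrow> 0 \<le> j" unfolding less_ceiling_iff[symmetric] j_def by auto
        finally show ?thesis .
      qed
      have hi: "t \<le> real n \<longleftrightarrow> j < int N"
      proof -
        have "t \<le> real n \<longleftrightarrow> 2 ^ n * t \<le> real_of_int (int n * 2 ^ n)"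
          using mult_le_cancel_right_pos[of "2 ^ n" t "real n"] by (simp add: mult.commute)
        also have "\<dots> \<longleftrightarrow> j < int N" unfolding ceiling_le_iff[symmetric] j_def N_def by auto
        finally show ?thesis .
      qed
      show ?thesis
      proof (cases "0 \<le> j \<and> j < int N")
        case True
        then have k: "int (nat j) = j" "nat j < N" by auto
        have "(\<Sum>k<N. c k * indicator {x k<..x (Suc k)} t) = (\<Sum>k<N. if k = nat j then c k else 0)"
          by (rule sum.cong) (use inx k in \<open>auto simp: indicator_def\<close>)
        also have "\<dots> = c (nat j)" using k by simp
        also have "{x (nat j)..x (Suc (nat j))} = cell n t"
        proof -
          have "real (nat j) = real_of_int j" using True by simp
          then show ?thesis unfolding cell_def cl x_def by (simp add: field_simps)
        qed
        then have "c (nat j) = s n t" using True lo hi by (simp add: c_def s_def)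
        finally show ?thesis by simp
      next
        case False
        have "(\<Sum>k<N. c k * indicator {x k<..x (Suc k)} t) = 0"
          by (rule sum.neutral) (use inx False in \<open>auto simp: indicator_def\<close>)
        then show ?thesis using False lo hi by (auto simp: s_def)
      qed
    qed
    ultimately show ?thesis by blast
  qed
qed

section \<open>Continuous functions of X\<close>

context daniell_integral
begin

lemma L0_up_val_continuous:
  assumes g: "continuous_on UNIV g" and nonneg: "\<And>t. 0 \<le> g t"
  shows "L0_up_val K E X g (ccomp K g X)"
proof -
  obtain s where s: "\<And>n. \<exists>x c N. strict_mono x \<and> s n = (\<lambda>t. \<Sum>k<N. c k * indicator {x k<..x (Suc k)} t)"
    and inc: "\<And>t. incseq (\<lambda>n. s n t)" and lim: "\<And>t. (\<lambda>n. s n t) \<longlonglongrightarrow> g t"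
    using continuous_step_approximation[OF g nonneg] by blast
  have "\<exists>v. daniell_L_val K E X (s n) v" for n
  proof -
    obtain x c N where "strict_mono x" "s n = (\<lambda>t. \<Sum>k<N. c k * indicator {x k<..x (Suc k)} t)"
      using s by blast
    then show ?thesis using daniell_L_val_step_function by simp
  qed
  then obtain vs where vs: "\<And>n. daniell_L_val K E X (s n) (vs n)" by metis
  note vsE = daniell_L_val_props(1)[OF vs]
  let ?z = "ccomp K g X"
  note z = ccomp_props[OF E_cinf[OF X] g]
  have zc: "continuous_map K euclidean ?z" "extensional_on K ?z" using z(1) by (simp_all add: cinf_def)
  have vs_res: "\<forall>\<^sub>F \<omega> in residual K. \<forall>n\<in>UNIV. vs n \<omega> = ereal (s n (real_of_ereal (X \<omega>)))"
    by (rule eventually_residual_all_countable) (use daniell_L_val_props(2)[OF vs] in auto)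
  have "is_lub_in K (sup_compl K E) (range vs) ?z"
    unfolding is_lub_in_def
  \<comment> \<open>Positivity of \<open>g\<close> puts \<open>czero\<close> below
    \<open>?z\<close>, as the sup-completion demands. The supremum property is then verified
    directly: \<open>s n \<le> g\<close> gives the bound, and passing to the limit at almost every
    point gives leastness.\<close>
  proof (intro conjI ballI impI)
    have "cle K czero ?z"
      by (rule cle_residual[OF E_continuous[OF E_czero] zc(1)], rule eventually_mono[OF z(2)])
        (simp add: czero_def nonneg)
    then show "?z \<in> sup_compl K E" using zc E_czero by (auto simp: sup_compl_def)
  next
    fix b assume "b \<in> range vs"
    then obtain n where b: "b = vs n" by blast
    have "\<forall>\<^sub>F \<omega> in residual K. vs n \<omega> \<le> ?z \<omega>"
      using vs_res z(2)
    proof eventually_elim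
      case (elim \<omega>)
      then show ?case using incseq_le[OF inc lim, of n "real_of_ereal (X \<omega>)"] by simp
    qed
    then show "cle K b ?z" unfolding b by (rule cle_residual[OF E_continuous[OF vsE] zc(1)])
  next
    fix u assume u: "u \<in> sup_compl K E" "\<forall>b\<in>range vs. cle K b u"
    have "continuous_map K euclidean u" using u(1) by (simp add: sup_compl_def)
    moreover have "\<forall>\<^sub>F \<omega> in residual K. ?z \<omega> \<le> u \<omega>"
      using vs_res z(2) eventually_residual_topspace
    proof eventually_elim
      case (elim \<omega>)
      let ?x = "real_of_ereal (X \<omega>)"
      have "(\<lambda>n. ereal (s n ?x)) \<longlonglongrightarrow> ereal (g ?x)" using lim by simp
      then have "ereal (g ?x) \<le> u \<omega>"
      proof (rule LIMSEQ_le_const2, intro exI allI impI)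
        fix n
        have "vs n \<omega> \<le> u \<omega>" using u(2) elim(3) by (simp add: cle_def)
        then show "ereal (s n ?x) \<le> u \<omega>" using elim(1) by simp
      qed
      then show ?case using elim(2) by simp
    qed
    ultimately show "cle K ?z u" by (rule cle_residual[OF zc(1)])
  qed
  then show ?thesis unfolding L0_up_val_def daniell_up_val_def using vs inc lim nonneg by blast
qed

text \<open>Continuity is assumed only for the difference, because in an arbitrary representation
  \<open>g\<close> and \<open>h\<close> are merely increasing limits of step functions.\<close>

lemma cminus_L0_up_val:
  assumes "L0_up_val K E X g vg" "L0_up_val K E X h vh" "vg \<in> cinf K" "vh \<in> cinf K"
    and "continuous_on UNIV (\<lambda>t. g t - h t)"
  shows "cminus K vg vh = ccomp K (\<lambda>t. g t - h t) X"
proof (rule cinf_eqI)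
  show "cminus K vg vh \<in> cinf K" by (rule cminus_props(1)[OF assms(3,4)])
  show "ccomp K (\<lambda>t. g t - h t) X \<in> cinf K" by (rule ccomp_props(1)[OF E_cinf[OF X] assms(5)])
  have "daniell_up_val K E X g vg" "daniell_up_val K E X h vh"
    using assms(1,2) by (simp_all add: L0_up_val_def)
  then have "\<forall>\<^sub>F \<omega> in residual K. vg \<omega> = ereal (g (real_of_ereal (X \<omega>)))"
    "\<forall>\<^sub>F \<omega> in residual K. vh \<omega> = ereal (h (real_of_ereal (X \<omega>)))"
    by (simp_all add: daniell_up_val_residual)
  then show "\<forall>\<^sub>F \<omega> in residual K. cminus K vg vh \<omega> = ccomp K (\<lambda>t. g t - h t) X \<omega>"
    using cminus_props(3)[OF assms(3,4)] ccomp_props(2)[OF E_cinf[OF X] assms(5)]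
    by eventually_elim simp
qed

end

text \<open>The first conjunct is membership in the domain of the extended integral and keeps the
  second from being vacuous. The second evaluates every admissible representation, so it contains
  the independence of the representation.\<close>

theorem mainTheorem6:
  fixes K :: "'a topology" and E :: "('a \<Rightarrow> ereal) set"
    and X :: "'a \<Rightarrow> ereal" and f :: "real \<Rightarrow> real"
  assumes compact: "compact_space K"
    and hausdorff: "Hausdorff_space K"
    and extr_disc: "\<And>U. openin K U \<Longrightarrow> openin K (K closure_of U)"
    and ideal: "is_ideal_in K (cinf K) E"
    and dense: "order_dense_in K (cinf K) E"
    and complete: "order_complete K E"
    and unit: "cone K \<in> E"
    and X: "X \<in> E"
    and f_cont: "continuous_on UNIV f"
  shows "(\<exists>g h vg vh. L0_up_val K E X g vg \<and> L0_up_val K E X h vh \<and>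
            vg \<in> cinf K \<and> vh \<in> cinf K \<and> f = (\<lambda>t. g t - h t))
       \<and> (\<forall>g h vg vh. L0_up_val K E X g vg \<and> L0_up_val K E X h vh \<and>
            vg \<in> cinf K \<and> vh \<in> cinf K \<and> f = (\<lambda>t. g t - h t)
            \<longrightarrow> cminus K vg vh = ccomp K f X)
       \<and> ccomp K f X \<in> cinf K"
proof -
  interpret daniell_integral K E X
    using compact hausdorff extr_disc ideal unit X by unfold_locales
  have XC: "X \<in> cinf K" by (rule E_cinf[OF X])
  \<comment> \<open>Positive and negative parts of \<open>f\<close> are continuous and nonnegative,
    so each is the limit of an increasing sequence of step functions.\<close>
  let ?g = "\<lambda>t. max (f t) 0" and ?h = "\<lambda>t. max (- f t) 0"
  have cont: "continuous_on UNIV ?g" "continuous_on UNIV ?h"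
    using f_cont by (intro continuous_intros; simp)+
  have "f = (\<lambda>t. ?g t - ?h t)" by (auto simp: max_def)
  moreover have "L0_up_val K E X ?g (ccomp K ?g X)" "L0_up_val K E X ?h (ccomp K ?h X)"
    using cont by (auto intro: L0_up_val_continuous)
  ultimately have "\<exists>g h vg vh. L0_up_val K E X g vg \<and> L0_up_val K E X h vh \<and>
      vg \<in> cinf K \<and> vh \<in> cinf K \<and> f = (\<lambda>t. g t - h t)"
    using ccomp_props(1)[OF XC cont(1)] ccomp_props(1)[OF XC cont(2)] by blast
  moreover have "cminus K vg vh = ccomp K f X"
    if "L0_up_val K E X g vg" "L0_up_val K E X h vh" "vg \<in> cinf K" "vh \<in> cinf K"
      "f = (\<lambda>t. g t - h t)" for g h vg vh
    using cminus_L0_up_val[OF that(1-4)] f_cont that(5) by simp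
  ultimately show ?thesis using ccomp_props(1)[OF XC f_cont] by blast
qed

end
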